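(* Let $f$ be the exact solution of the Dirichlet problem described in the context, and assume that $f$ is sufficiently smooth and $\Delta t=h_1=h_2$. Let $f_{h,i,j}^n$ be the numerical solution of the uniform stopping time scheme described in the context, let $e_{i,j}^n=f_{h,i,j}^n-f(x_i,y_j,t_n)$ and $\|e^n\|_\infty=\max_{0\le i\le M_1,\,0\le j\le M_2}|e_{i,j}^n|$. Then the scheme satisfies $$\|e^n\|_\infty\le O(\Delta t).$$
   Context: **Problem.** $\Omega=(x_0,x_{M_1})\times(y_0,y_{M_2})$ is a fixed open rectangle and $T>0$. The functions $\rho,\sigma_1,\sigma_2,r,b_1,b_2$ are continuous on $\Omega\times[0,T)$, with $\rho\in[-1,1]$, $\sigma_1>0$, $\sigma_2>0$, $r\ge0$. The function $f$ solves $$\partial_t f+\tfrac12\sigma_1^2\,\partial_{xx}f+\rho\sigma_1\sigma_2\,\partial_{xy}f+\tfrac12\sigma_2^2\,\partial_{yy}f+b_1\partial_xf+b_2\partial_yf-rf=0\quad\text{on }\Omega\times[0,T),$$ with $f(x,y,T)=\varphi(x,y)$ on $\Omega$ and $f=f_\partial(x,y,t)$ on $\partial\Omega$ for $t\in[0,T)$, where $\varphi,f_\partial$ are given data. **Grid.** $h_1=(x_{M_1}-x_0)/M_1$, $h_2=(y_{M_2}-y_0)/M_2$, $\Delta t=T/N$; $x_i=x_0+ih_1$ ($0\le i\le M_1$), $y_j=y_0+jh_2$ ($0\le j\le M_2$), $t_n=n\Delta t$ ($0\le n\le N$). Interior nodes are those with $1\le i\le M_1-1$, $1\le j\le M_2-1$.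 **Branches.** Put $\theta=\tfrac12\arcsin\rho\in[-\pi/4,\pi/4]$. At an interior node and $0\le n\le N-1$, write $\sigma_k,b_k,r$ for the values at $(x_i,y_j,t_n)$ and $\alpha=\sin\theta+\cos\theta$, $\beta=\sin\theta-\cos\theta$ with $\theta$ evaluated at $(x_i,y_j,t_n)$. For $s\in[t_n,t_{n+1}]$, with $\hat s=s-t_n$, the four branches are $$\begin{aligned}(X_s^{h,1},Y_s^{h,1})&=(x_i+b_1\hat s+\alpha\sigma_1\sqrt{\hat s},\;y_j+b_2\hat s+\alpha\sigma_2\sqrt{\hat s}),\\(X_s^{h,2},Y_s^{h,2})&=(x_i+b_1\hat s-\beta\sigma_1\sqrt{\hat s},\;y_j+b_2\hat s+\beta\sigma_2\sqrt{\hat s}),\\(X_s^{h,3},Y_s^{h,3})&=(x_i+b_1\hat s-\alpha\sigma_1\sqrt{\hat s},\;y_j+b_2\hat s-\alpha\sigma_2\sqrt{\hat s}),\\(X_s^{h,4},Y_s^{h,4})&=(x_i+b_1\hat s+\beta\sigma_1\sqrt{\hat s},\;y_j+b_2\hat s-\beta\sigma_2\sqrt{\hat s}).\end{aligned}$$ Let $\tau_k=\min\bigl(t_{n+1},\inf\{s\ge t_n:(X_s^{h,k},Y_s^{h,k})\notin\Omega\}\bigr)$, and define the uniform stopping time $\tau=\min_{1\le k\le4}\tau_k$ and $\hat\tau=\tau-t_n$ (these depend on $i,j,n$). **Interpolation.** $\mathcal L^{\mathrm{sp}}g(x,y,t_m)$ is the bilinear interpolant in space, at time level $t_m$, of the grid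 values of $g$ at the four vertices of the grid cell containing $(x,y)$. For $t\in[t_n,t_{n+1}]$, $\mathcal L^{\mathrm{st}}g(x,y,t)=\frac{t_{n+1}-t}{\Delta t}\,\mathcal L^{\mathrm{sp}}g(x,y,t_n)+\frac{t-t_n}{\Delta t}\,\mathcal L^{\mathrm{sp}}g(x,y,t_{n+1})$ (space-time trilinear interpolation). **Scheme.** Set $f_{h,i,j}^N=\varphi(x_i,y_j)$ at all nodes, and at boundary nodes use the boundary data, $f_{h,i,j}^n=f_\partial(x_i,y_j,t_n)$ for $n<N$. For $n=N-1,\dots,0$ the values at the interior nodes at level $n$ are the solution of the (in general coupled, implicit) linear system $$f_{h,i,j}^n=\frac{1}{4(1+r\hat\tau)}\sum_{k=1}^4U_k,$$ where $U_k=f_\partial(X_\tau^{h,k},Y_\tau^{h,k},\tau)$ if $(X_\tau^{h,k},Y_\tau^{h,k})\in\partial\Omega$; otherwise $U_k=\mathcal L^{\mathrm{sp}}f_h(X_\tau^{h,k},Y_\tau^{h,k},t_{n+1})$ if $\tau=t_{n+1}$, and $U_k=\mathcal L^{\mathrm{st}}f_h(X_\tau^{h,k},Y_\tau^{h,k},\tau)$ if $\tau<t_{n+1}$.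
   Formalization: The formal theorem also assumes σ1, σ2, b1, b2 bounded on Ω×[0,T), since the claim fails for coefficients blowing up at T, and takes φ and f_∂ continuous up to ∂Ω and t=T, where the scheme reads them; "sufficiently smooth" means C^4 up to the boundary. *)

theory Defs
  imports "HOL-Analysis.Analysis"
begin

section \<open>The Dirichlet problem\<close>

text \<open>Functions of \<open>(x, y, t)\<close> are curried. The coefficients are
  \<open>rho, sigma1, sigma2, rate\<close> (the zeroth-order coefficient \<open>r\<close>),
  \<open>drift1, drift2\<close> (\<open>b\<^sub>1, b\<^sub>2\<close>); the data are the terminal value
  \<open>phi\<close> and the lateral boundary value \<open>fbd\<close>.\<close>

record problem =
  xl :: real
  xr :: real
  yl :: real
  yr :: real
  horizon :: real
  rho :: "real \<Rightarrow> real \<Rightarrow> real \<Rightarrow> real"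
  sigma1 :: "real \<Rightarrow> real \<Rightarrow> real \<Rightarrow> real"
  sigma2 :: "real \<Rightarrow> real \<Rightarrow> real \<Rightarrow> real"
  rate :: "real \<Rightarrow> real \<Rightarrow> real \<Rightarrow> real"
  drift1 :: "real \<Rightarrow> real \<Rightarrow> real \<Rightarrow> real"
  drift2 :: "real \<Rightarrow> real \<Rightarrow> real \<Rightarrow> real"
  phi :: "real \<Rightarrow> real \<Rightarrow> real"
  fbd :: "real \<Rightarrow> real \<Rightarrow> real \<Rightarrow> real"

definition Omega :: "problem \<Rightarrow> (real \<times> real) set" where
  "Omega P = {xl P<..<xr P} \<times> {yl P<..<yr P}"

definition continuous_on3 ::
    "(real \<times> real) set \<Rightarrow> real set \<Rightarrow> (real \<Rightarrow> real \<Rightarrow> real \<Rightarrow> real) \<Rightarrow> bool" where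
  "continuous_on3 S I g \<longleftrightarrow> continuous_on (S \<times> I) (\<lambda>((x, y), t). g x y t)"

definition bounded_on3 ::
    "(real \<times> real) set \<Rightarrow> real set \<Rightarrow> (real \<Rightarrow> real \<Rightarrow> real \<Rightarrow> real) \<Rightarrow> bool" where
  "bounded_on3 S I g \<longleftrightarrow> bounded ((\<lambda>((x, y), t). g x y t) ` (S \<times> I))"

definition admissible :: "problem \<Rightarrow> bool" where
  "admissible P \<longleftrightarrow>
     xl P < xr P \<and> yl P < yr P \<and> 0 < horizon P \<and>
     (\<forall>g \<in> {rho P, sigma1 P, sigma2 P, rate P, drift1 P, drift2 P}.
        continuous_on3 (Omega P) {0..<horizon P} g) \<and>
     (\<forall>(x, y) \<in> Omega P. \<forall>t \<in> {0..<horizon P}.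
        rho P x y t \<in> {-1..1} \<and> 0 < sigma1 P x y t \<and> 0 < sigma2 P x y t \<and> 0 \<le> rate P x y t)"

text \<open>Partial derivatives on the closed cylinder, hence one-sided on its faces; at points of
  the open cylinder they are the ordinary partial derivatives.\<close>

definition pdx ::
    "problem \<Rightarrow> (real \<Rightarrow> real \<Rightarrow> real \<Rightarrow> real) \<Rightarrow> real \<Rightarrow> real \<Rightarrow> real \<Rightarrow> real" where
  "pdx P g = (\<lambda>x y t. vector_derivative (\<lambda>u. g u y t) (at x within {xl P..xr P}))"

definition pdy ::
    "problem \<Rightarrow> (real \<Rightarrow> real \<Rightarrow> real \<Rightarrow> real) \<Rightarrow> real \<Rightarrow> real \<Rightarrow> real \<Rightarrow> real" where
  "pdy P g = (\<lambda>x y t. vector_derivative (\<lambda>v. g x v t) (at y within {yl P..yr P}))"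

definition pdt ::
    "problem \<Rightarrow> (real \<Rightarrow> real \<Rightarrow> real \<Rightarrow> real) \<Rightarrow> real \<Rightarrow> real \<Rightarrow> real \<Rightarrow> real" where
  "pdt P g = (\<lambda>x y t. vector_derivative (\<lambda>s. g x y s) (at t within {0..horizon P}))"

text \<open>Class \<open>C\<close>-\<open>k\<close>, jointly in \<open>(x, y, t)\<close>, up to the boundary of the cylinder.\<close>

primrec smooth_cyl :: "problem \<Rightarrow> nat \<Rightarrow> (real \<Rightarrow> real \<Rightarrow> real \<Rightarrow> real) \<Rightarrow> bool" where
  "smooth_cyl P 0 g \<longleftrightarrow> continuous_on3 (closure (Omega P)) {0..horizon P} g"
| "smooth_cyl P (Suc k) g \<longleftrightarrow>
     continuous_on3 (closure (Omega P)) {0..horizon P} g \<and>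
     (\<forall>(x, y) \<in> closure (Omega P). \<forall>t \<in> {0..horizon P}.
        (\<lambda>u. g u y t) differentiable (at x within {xl P..xr P}) \<and>
        (\<lambda>v. g x v t) differentiable (at y within {yl P..yr P}) \<and>
        (\<lambda>s. g x y s) differentiable (at t within {0..horizon P})) \<and>
     smooth_cyl P k (pdx P g) \<and> smooth_cyl P k (pdy P g) \<and> smooth_cyl P k (pdt P g)"

definition solves_pde :: "problem \<Rightarrow> (real \<Rightarrow> real \<Rightarrow> real \<Rightarrow> real) \<Rightarrow> bool" where
  "solves_pde P f \<longleftrightarrow>
     (\<forall>(x, y) \<in> Omega P. \<forall>t \<in> {0..<horizon P}.
        pdt P f x y t
        + 1/2 * (sigma1 P x y t)\<^sup>2 * pdx P (pdx P f) x y t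
        + rho P x y t * sigma1 P x y t * sigma2 P x y t * pdx P (pdy P f) x y t
        + 1/2 * (sigma2 P x y t)\<^sup>2 * pdy P (pdy P f) x y t
        + drift1 P x y t * pdx P f x y t
        + drift2 P x y t * pdy P f x y t
        - rate P x y t * f x y t = 0)"

definition exact_solution :: "problem \<Rightarrow> (real \<Rightarrow> real \<Rightarrow> real \<Rightarrow> real) \<Rightarrow> bool" where
  "exact_solution P f \<longleftrightarrow>
     solves_pde P f \<and>
     (\<forall>(x, y) \<in> Omega P. f x y (horizon P) = phi P x y) \<and>
     (\<forall>(x, y) \<in> frontier (Omega P). \<forall>t \<in> {0..<horizon P}. f x y t = fbd P x y t)"

text \<open>The scheme evaluates \<open>phi\<close> at boundary nodes, and \<open>fbd\<close> at the terminal time (when a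
  branch of the last time step meets the boundary exactly at \<open>t = T\<close>). These values lie outside
  the sets on which the data enter the Dirichlet problem; they are the continuous extensions.\<close>

definition data_continuous :: "problem \<Rightarrow> bool" where
  "data_continuous P \<longleftrightarrow>
     continuous_on (closure (Omega P)) (\<lambda>(x, y). phi P x y) \<and>
     continuous_on3 (frontier (Omega P)) {0..horizon P} (fbd P)"

section \<open>The grid\<close>

record grid =
  M1 :: nat
  M2 :: nat
  N :: nat

definition h1 :: "problem \<Rightarrow> grid \<Rightarrow> real" where
  "h1 P G = (xr P - xl P) / real (M1 G)"

definition h2 :: "problem \<Rightarrow> grid \<Rightarrow> real" where
  "h2 P G = (yr P - yl P) / real (M2 G)"

definition dt :: "problem \<Rightarrow> grid \<Rightarrow> real" where
  "dt P G = horizon P / real (N G)"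

definition xn :: "problem \<Rightarrow> grid \<Rightarrow> nat \<Rightarrow> real" where
  "xn P G i = xl P + real i * h1 P G"

definition yn :: "problem \<Rightarrow> grid \<Rightarrow> nat \<Rightarrow> real" where
  "yn P G j = yl P + real j * h2 P G"

definition tn :: "problem \<Rightarrow> grid \<Rightarrow> nat \<Rightarrow> real" where
  "tn P G n = real n * dt P G"

definition interior_node :: "grid \<Rightarrow> nat \<Rightarrow> nat \<Rightarrow> bool" where
  "interior_node G i j \<longleftrightarrow> 1 \<le> i \<and> i < M1 G \<and> 1 \<le> j \<and> j < M2 G"

section \<open>Branches and the uniform stopping time\<close>

definition theta :: "problem \<Rightarrow> real \<Rightarrow> real \<Rightarrow> real \<Rightarrow> real" where
  "theta P x y t = arcsin (rho P x y t) / 2"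

definition alpha :: "problem \<Rightarrow> real \<Rightarrow> real \<Rightarrow> real \<Rightarrow> real" where
  "alpha P x y t = sin (theta P x y t) + cos (theta P x y t)"

definition beta :: "problem \<Rightarrow> real \<Rightarrow> real \<Rightarrow> real \<Rightarrow> real" where
  "beta P x y t = sin (theta P x y t) - cos (theta P x y t)"

text \<open>Factors of \<open>\<sigma>\<^sub>1 \<surd>(s - t\<^sub>n)\<close> and \<open>\<sigma>\<^sub>2 \<surd>(s - t\<^sub>n)\<close> in
  branch \<open>k \<in> {1, 2, 3, 4}\<close>, given \<open>\<alpha>\<close> and \<open>\<beta>\<close>.\<close>

definition branch_dir :: "real \<Rightarrow> real \<Rightarrow> nat \<Rightarrow> real \<times> real" where
  "branch_dir al be k =
     (if k = 1 then (al, al) else if k = 2 then (- be, be)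
      else if k = 3 then (- al, - al) else (be, - be))"

definition branch ::
    "problem \<Rightarrow> grid \<Rightarrow> nat \<Rightarrow> nat \<Rightarrow> nat \<Rightarrow> nat \<Rightarrow> real \<Rightarrow> real \<times> real" where
  "branch P G i j n k s =
     (let x = xn P G i; y = yn P G j; t = tn P G n;
          d = branch_dir (alpha P x y t) (beta P x y t) k
      in (x + drift1 P x y t * (s - t) + fst d * sigma1 P x y t * sqrt (s - t),
          y + drift2 P x y t * (s - t) + snd d * sigma2 P x y t * sqrt (s - t)))"

text \<open>Inserting \<open>t\<^bsub>n+1\<^esub>\<close> into the exit set gives
  \<open>min t\<^bsub>n+1\<^esub> (inf \<dots>)\<close> with the convention that the infimum of the empty set
  is \<open>+\<infinity>\<close>.\<close>

definition tau_k ::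
    "problem \<Rightarrow> grid \<Rightarrow> nat \<Rightarrow> nat \<Rightarrow> nat \<Rightarrow> nat \<Rightarrow> real" where
  "tau_k P G i j n k =
     Inf (insert (tn P G (Suc n)) {s. tn P G n \<le> s \<and> branch P G i j n k s \<notin> Omega P})"

definition tau :: "problem \<Rightarrow> grid \<Rightarrow> nat \<Rightarrow> nat \<Rightarrow> nat \<Rightarrow> real" where
  "tau P G i j n = Min (tau_k P G i j n ` {1..4})"

section \<open>Interpolation and the scheme\<close>

text \<open>A grid function is written \<open>g n i j\<close>, with the time index first. The cell index is
  clamped so that points on the right and upper edges use the last cell.\<close>

definition cell :: "real \<Rightarrow> real \<Rightarrow> nat \<Rightarrow> real \<Rightarrow> nat" where
  "cell z0 h M z = min (nat \<lfloor>(z - z0) / h\<rfloor>) (M - 1)"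

definition interp_sp ::
    "problem \<Rightarrow> grid \<Rightarrow> (nat \<Rightarrow> nat \<Rightarrow> nat \<Rightarrow> real) \<Rightarrow> nat \<Rightarrow> real \<times> real \<Rightarrow> real" where
  "interp_sp P G g m = (\<lambda>(x, y).
     (let p = cell (xl P) (h1 P G) (M1 G) x;
          q = cell (yl P) (h2 P G) (M2 G) y;
          u = (x - xn P G p) / h1 P G;
          v = (y - yn P G q) / h2 P G
      in (1 - u) * (1 - v) * g m p q + u * (1 - v) * g m (Suc p) q
         + (1 - u) * v * g m p (Suc q) + u * v * g m (Suc p) (Suc q)))"

definition interp_st ::
    "problem \<Rightarrow> grid \<Rightarrow> (nat \<Rightarrow> nat \<Rightarrow> nat \<Rightarrow> real) \<Rightarrow> nat \<Rightarrow> real \<times> real \<Rightarrow> real \<Rightarrow> real" where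
  "interp_st P G g n z t =
     (tn P G (Suc n) - t) / dt P G * interp_sp P G g n z
     + (t - tn P G n) / dt P G * interp_sp P G g (Suc n) z"

definition U ::
    "problem \<Rightarrow> grid \<Rightarrow> (nat \<Rightarrow> nat \<Rightarrow> nat \<Rightarrow> real) \<Rightarrow> nat \<Rightarrow> nat \<Rightarrow> nat \<Rightarrow> nat \<Rightarrow> real" where
  "U P G g i j n k =
     (let ta = tau P G i j n; z = branch P G i j n k ta
      in if z \<in> frontier (Omega P) then fbd P (fst z) (snd z) ta
         else if ta = tn P G (Suc n) then interp_sp P G g (Suc n) z
         else interp_st P G g n z ta)"

definition numerical_solution ::
    "problem \<Rightarrow> grid \<Rightarrow> (nat \<Rightarrow> nat \<Rightarrow> nat \<Rightarrow> real) \<Rightarrow> bool" where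
  "numerical_solution P G fh \<longleftrightarrow>
     (\<forall>i \<le> M1 G. \<forall>j \<le> M2 G. fh (N G) i j = phi P (xn P G i) (yn P G j)) \<and>
     (\<forall>n < N G. \<forall>i \<le> M1 G. \<forall>j \<le> M2 G.
        fh n i j =
          (if interior_node G i j
           then 1 / (4 * (1 + rate P (xn P G i) (yn P G j) (tn P G n)
                                * (tau P G i j n - tn P G n)))
                * (\<Sum>k = 1..4. U P G fh i j n k)
           else fbd P (xn P G i) (yn P G j) (tn P G n)))"

definition error_norm ::
    "problem \<Rightarrow> grid \<Rightarrow> (real \<Rightarrow> real \<Rightarrow> real \<Rightarrow> real) \<Rightarrow> (nat \<Rightarrow> nat \<Rightarrow> nat \<Rightarrow> real) \<Rightarrow> nat \<Rightarrow> real" where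
  "error_norm P G f fh n =
     Max ((\<lambda>(i, j). \<bar>fh n i j - f (xn P G i) (yn P G j) (tn P G n)\<bar>) ` ({0..M1 G} \<times> {0..M2 G}))"

end

theory Submission
  imports Defs
begin

text \<open>
  Let \<open>e\<close> be the nodal error and \<open>err n\<close> its maximum at level \<open>n\<close>, and write \<open>h\<close> for the common
  step size and \<open>\<delta> \<le> h\<close> for the time from \<open>t\<^sub>n\<close> to the uniform stop.

  \<^emph>\<open>Consistency.\<close> The four branches have the mean and the covariance of the diffusion, and their
  third moments vanish, up to \<open>O(\<delta>\<^sup>2)\<close>. Averaging a Taylor expansion of \<open>f\<close> over them and using
  the differential equation gives \<open>(1 + r \<delta>) f\<close> up to \<open>O(\<delta>\<^sup>2)\<close> (\<open>branches_consistent\<close>). It is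
  essential that the branches stop at the same time, since only then do the odd moments cancel.
  Replacing \<open>f\<close> at the branch endpoints by interpolated nodal values costs \<open>O(h\<^sup>2)\<close> and does
  not amplify nodal errors, because the weights are convex (\<open>interp_sp_error\<close>,
  \<open>interp_st_error\<close>).

  \<^emph>\<open>Stability.\<close> If no branch stops early, \<open>\<delta> = h\<close>, only level \<open>n + 1\<close> enters, and the local error
  is \<open>O(h\<^sup>2)\<close>. If some branch stops early, \<open>\<delta>\<close> may be of the order of \<open>h\<^sup>2\<close>, and the interpolation
  error \<open>O(h\<^sup>2)\<close> is then not small compared with \<open>\<delta>\<close>. But that branch ends on the boundary, where
  the numerical value is exact (\<open>early_stop_on_frontier\<close>), so at most three of the four branches
  contribute an error. Together (\<open>interior_error_recursion\<close>),
  \<open>err n \<le> max (err (n + 1)) (3/4 * max (err n) (err (n + 1))) + O(h\<^sup>2)\<close>.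
  The unknown \<open>err n\<close> on the right carries the factor \<open>3/4\<close> and can be absorbed, which leaves
  \<open>err n \<le> err (n + 1) + O(h\<^sup>2)\<close> (\<open>err_step\<close>). Since \<open>err N = 0\<close> and there are \<open>T / h\<close> steps, the
  error is \<open>O(h)\<close>.
\<close>

section \<open>Bounded derivatives and Taylor expansion on the closed cylinder\<close>

definition in_cyl :: "problem \<Rightarrow> real \<Rightarrow> real \<Rightarrow> real \<Rightarrow> bool" where
  "in_cyl P x y t \<longleftrightarrow> x \<in> {xl P..xr P} \<and> y \<in> {yl P..yr P} \<and> t \<in> {0..horizon P}"

lemma closure_Omega:
  assumes "admissible P"
  shows "closure (Omega P) = {xl P..xr P} \<times> {yl P..yr P}"
  using assms by (simp add: admissible_def Omega_def closure_Times)

lemma open_Omega: "open (Omega P)"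
  by (simp add: Omega_def open_Times)

lemma frontier_Omega: "frontier (Omega P) = closure (Omega P) - Omega P"
  by (simp add: frontier_def interior_open open_Omega)

text \<open>A quantitative form of the smoothness assumption: one constant for all partial
  derivatives up to order \<open>k\<close>, in every order of differentiation, so that Taylor remainders
  in any of the three variables are controlled by the same \<open>B\<close>.\<close>

primrec bounded_derivs ::
    "problem \<Rightarrow> real \<Rightarrow> nat \<Rightarrow> (real \<Rightarrow> real \<Rightarrow> real \<Rightarrow> real) \<Rightarrow> bool" where
  "bounded_derivs P B 0 g \<longleftrightarrow> (\<forall>x y t. in_cyl P x y t \<longrightarrow> \<bar>g x y t\<bar> \<le> B)"
| "bounded_derivs P B (Suc k) g \<longleftrightarrow>
     (\<forall>x y t. in_cyl P x y t \<longrightarrow>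
        \<bar>g x y t\<bar> \<le> B \<and>
        ((\<lambda>u. g u y t) has_real_derivative pdx P g x y t) (at x within {xl P..xr P}) \<and>
        ((\<lambda>v. g x v t) has_real_derivative pdy P g x y t) (at y within {yl P..yr P}) \<and>
        ((\<lambda>s. g x y s) has_real_derivative pdt P g x y t) (at t within {0..horizon P})) \<and>
     bounded_derivs P B k (pdx P g) \<and> bounded_derivs P B k (pdy P g) \<and>
     bounded_derivs P B k (pdt P g)"

lemma bounded_derivs_mono:
  "bounded_derivs P B k g \<Longrightarrow> B \<le> B' \<Longrightarrow> bounded_derivs P B' k g"
  by (induction k arbitrary: g) force+

lemma bounded_derivs_abs_le:
  "bounded_derivs P B k g \<Longrightarrow> in_cyl P x y t \<Longrightarrow> \<bar>g x y t\<bar> \<le> B"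
  by (cases k) auto

lemma bounded_derivs_lower_order:
  "bounded_derivs P B k g \<Longrightarrow> l \<le> k \<Longrightarrow> bounded_derivs P B l g"
proof (induction k arbitrary: l g)
  case (Suc k)
  then show ?case by (cases l) auto
qed auto

lemma bounded_derivs_partials:
  assumes "bounded_derivs P B (Suc k) g"
  shows "bounded_derivs P B k (pdx P g)" and "bounded_derivs P B k (pdy P g)"
    and "bounded_derivs P B k (pdt P g)"
  using assms by auto

lemma smooth_cyl_continuous:
  "smooth_cyl P k g \<Longrightarrow> continuous_on3 (closure (Omega P)) {0..horizon P} g"
  by (cases k) auto

lemma continuous_on3_imp_bounded:
  assumes "admissible P" and "continuous_on3 (closure (Omega P)) {0..horizon P} g"
  shows "\<exists>B. \<forall>x y t. in_cyl P x y t \<longrightarrow> \<bar>g x y t\<bar> \<le> B"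
proof -
  have "compact (closure (Omega P) \<times> {0..horizon P})"
    using assms(1) by (simp add: closure_Omega compact_Times)
  then have "bounded ((\<lambda>((x, y), t). g x y t) ` (closure (Omega P) \<times> {0..horizon P}))"
    using assms(2) unfolding continuous_on3_def
    by (intro compact_imp_bounded compact_continuous_image)
  then obtain B where
    "\<forall>z \<in> (\<lambda>((x, y), t). g x y t) ` (closure (Omega P) \<times> {0..horizon P}). \<bar>z\<bar> \<le> B"
    by (auto simp: bounded_iff)
  then have "\<forall>x y t. in_cyl P x y t \<longrightarrow> \<bar>g x y t\<bar> \<le> B"
    using assms(1) by (force simp: in_cyl_def closure_Omega)
  then show ?thesis by blast
qed

lemma differentiable_imp_has_real_derivative_vector_derivative:
  fixes g :: "real \<Rightarrow> real"
  assumes "g differentiable (at x within {a..b})" and "a < b" and "x \<in> {a..b}"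
  shows "(g has_real_derivative vector_derivative g (at x within {a..b})) (at x within {a..b})"
proof -
  have "\<exists>d. (g has_vector_derivative d) (at x within {a..b})"
    using assms(1)
    by (metis has_real_derivative_iff_has_vector_derivative real_differentiableE)
  then obtain d where d: "(g has_vector_derivative d) (at x within {a..b})" by blast
  then have "vector_derivative g (at x within {a..b}) = d"
    using vector_derivative_within_closed_interval[OF assms(2,3)] by blast
  then show ?thesis
    using d by (simp add: has_real_derivative_iff_has_vector_derivative)
qed

lemma smooth_cyl_imp_bounded_derivs:
  assumes adm: "admissible P" and "smooth_cyl P k g"
  shows "\<exists>B. bounded_derivs P B k g"
  using assms(2)
proof (induction k arbitrary: g)
  case 0
  then show ?case using continuous_on3_imp_bounded[OF adm] by simp
next
  case (Suc k)
  then obtain Bx By Bt where B: "bounded_derivs P Bx k (pdx P g)"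
      "bounded_derivs P By k (pdy P g)" "bounded_derivs P Bt k (pdt P g)"
    by (metis smooth_cyl.simps(2))
  obtain B0 where B0: "\<forall>x y t. in_cyl P x y t \<longrightarrow> \<bar>g x y t\<bar> \<le> B0"
    using continuous_on3_imp_bounded[OF adm smooth_cyl_continuous[OF Suc.prems]] by blast
  let ?B = "max (max Bx By) (max Bt B0)"
  have lims: "xl P < xr P" "yl P < yr P" "0 < horizon P"
    using adm by (auto simp: admissible_def)
  have "bounded_derivs P ?B k (pdx P g)" "bounded_derivs P ?B k (pdy P g)"
      "bounded_derivs P ?B k (pdt P g)"
    using B by (auto elim!: bounded_derivs_mono)
  moreover have "\<bar>g x y t\<bar> \<le> ?B" if "in_cyl P x y t" for x y t
    using B0 that by (meson max.coboundedI2)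
  moreover have
    "((\<lambda>u. g u y t) has_real_derivative pdx P g x y t) (at x within {xl P..xr P})"
    "((\<lambda>v. g x v t) has_real_derivative pdy P g x y t) (at y within {yl P..yr P})"
    "((\<lambda>s. g x y s) has_real_derivative pdt P g x y t) (at t within {0..horizon P})"
    if "in_cyl P x y t" for x y t
    using Suc.prems that lims unfolding pdx_def pdy_def pdt_def
    by (auto simp: in_cyl_def closure_Omega[OF adm]
        intro!: differentiable_imp_has_real_derivative_vector_derivative)
  ultimately show ?case by auto
qed

lemma bounded_derivs_iterate:
  assumes "bounded_derivs P B (m + k) g"
  shows "bounded_derivs P B k ((pdx P ^^ m) g)"
    and "bounded_derivs P B k ((pdy P ^^ m) g)"
    and "bounded_derivs P B k ((pdt P ^^ m) g)"
  using assms by (induction m arbitrary: g) (auto simp: funpow_Suc_right simp del: funpow.simps)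

text \<open>One-variable expansions in each of the three directions. Applied one direction after the
  other, with \<open>y\<close> before \<open>x\<close>, they produce the mixed derivatives in exactly the order in which
  the differential equation contains them, so partial derivatives are never interchanged.\<close>

lemma taylor_x:
  assumes g: "bounded_derivs P B (Suc n) g"
    and "in_cyl P x y t" and "in_cyl P x' y t"
  shows "\<bar>g x' y t - (\<Sum>i\<le>n. (pdx P ^^ i) g x y t * (x' - x) ^ i / fact i)\<bar>
           \<le> B * \<bar>x' - x\<bar> ^ Suc n / fact n"
proof -
  have "norm ((pdx P ^^ 0) g x' y t - (\<Sum>i\<le>n. (pdx P ^^ i) g x y t * (x' - x) ^ i / fact i))
          \<le> B * norm (x' - x) ^ Suc n / fact n"
  proof (rule field_Taylor[where S = "{xl P..xr P}" and f = "\<lambda>i u. (pdx P ^^ i) g u y t"])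
    fix i u assume u: "u \<in> {xl P..xr P}" and i: "i \<le> n"
    have "bounded_derivs P B (Suc (n - i)) ((pdx P ^^ i) g)"
      using g i by (intro bounded_derivs_iterate) (simp add: Suc_diff_le)
    then show "((\<lambda>u. (pdx P ^^ i) g u y t) has_real_derivative (pdx P ^^ Suc i) g u y t)
                 (at u within {xl P..xr P})"
      using u assms(2) by (auto simp: in_cyl_def)
  next
    fix u assume "u \<in> {xl P..xr P}"
    then show "norm ((pdx P ^^ Suc n) g u y t) \<le> B"
      using bounded_derivs_iterate(1)[of P B "Suc n" 0 g] g assms(2)
      by (auto simp: in_cyl_def simp del: funpow.simps bounded_derivs.simps(2))
  qed (use assms in \<open>auto simp: in_cyl_def\<close>)
  then show ?thesis by simp
qed

lemma taylor_y:
  assumes g: "bounded_derivs P B (Suc n) g"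
    and "in_cyl P x y t" and "in_cyl P x y' t"
  shows "\<bar>g x y' t - (\<Sum>i\<le>n. (pdy P ^^ i) g x y t * (y' - y) ^ i / fact i)\<bar>
           \<le> B * \<bar>y' - y\<bar> ^ Suc n / fact n"
proof -
  have "norm ((pdy P ^^ 0) g x y' t - (\<Sum>i\<le>n. (pdy P ^^ i) g x y t * (y' - y) ^ i / fact i))
          \<le> B * norm (y' - y) ^ Suc n / fact n"
  proof (rule field_Taylor[where S = "{yl P..yr P}" and f = "\<lambda>i v. (pdy P ^^ i) g x v t"])
    fix i v assume v: "v \<in> {yl P..yr P}" and i: "i \<le> n"
    have "bounded_derivs P B (Suc (n - i)) ((pdy P ^^ i) g)"
      using g i by (intro bounded_derivs_iterate) (simp add: Suc_diff_le)
    then show "((\<lambda>v. (pdy P ^^ i) g x v t) has_real_derivative (pdy P ^^ Suc i) g x v t)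
                 (at v within {yl P..yr P})"
      using v assms(2) by (auto simp: in_cyl_def)
  next
    fix v assume "v \<in> {yl P..yr P}"
    then show "norm ((pdy P ^^ Suc n) g x v t) \<le> B"
      using bounded_derivs_iterate(2)[of P B "Suc n" 0 g] g assms(2)
      by (auto simp: in_cyl_def simp del: funpow.simps bounded_derivs.simps(2))
  qed (use assms in \<open>auto simp: in_cyl_def\<close>)
  then show ?thesis by simp
qed

lemma taylor_t:
  assumes g: "bounded_derivs P B (Suc n) g"
    and "in_cyl P x y t" and "in_cyl P x y t'"
  shows "\<bar>g x y t' - (\<Sum>i\<le>n. (pdt P ^^ i) g x y t * (t' - t) ^ i / fact i)\<bar>
           \<le> B * \<bar>t' - t\<bar> ^ Suc n / fact n"
proof -
  have "norm ((pdt P ^^ 0) g x y t' - (\<Sum>i\<le>n. (pdt P ^^ i) g x y t * (t' - t) ^ i / fact i))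
          \<le> B * norm (t' - t) ^ Suc n / fact n"
  proof (rule field_Taylor[where S = "{0..horizon P}" and f = "\<lambda>i s. (pdt P ^^ i) g x y s"])
    fix i s assume s: "s \<in> {0..horizon P}" and i: "i \<le> n"
    have "bounded_derivs P B (Suc (n - i)) ((pdt P ^^ i) g)"
      using g i by (intro bounded_derivs_iterate) (simp add: Suc_diff_le)
    then show "((\<lambda>s. (pdt P ^^ i) g x y s) has_real_derivative (pdt P ^^ Suc i) g x y s)
                 (at s within {0..horizon P})"
      using s assms(2) by (auto simp: in_cyl_def)
  next
    fix s assume "s \<in> {0..horizon P}"
    then show "norm ((pdt P ^^ Suc n) g x y s) \<le> B"
      using bounded_derivs_iterate(3)[of P B "Suc n" 0 g] g assms(2)
      by (auto simp: in_cyl_def simp del: funpow.simps bounded_derivs.simps(2))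
  qed (use assms in \<open>auto simp: in_cyl_def\<close>)
  then show ?thesis by simp
qed

lemma abs_mult_le:
  fixes p q X Y :: real
  assumes "\<bar>p\<bar> \<le> X" and "\<bar>q\<bar> \<le> Y"
  shows "\<bar>p * q\<bar> \<le> X * Y"
  using assms by (simp add: abs_mult mult_mono)

text \<open>The parabolic Taylor polynomial: increments \<open>a, b\<close> in space count with weight one and the
  increment \<open>c\<close> in time with weight two. All terms of weight at most three are kept.\<close>

definition taylor_poly ::
    "problem \<Rightarrow> (real \<Rightarrow> real \<Rightarrow> real \<Rightarrow> real) \<Rightarrow> real \<Rightarrow> real \<Rightarrow> real \<Rightarrow>
     real \<Rightarrow> real \<Rightarrow> real \<Rightarrow> real" where
  "taylor_poly P f x y t a b c =
     f x y t + c * pdt P f x y t + a * pdx P f x y t + b * pdy P f x y t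
     + a\<^sup>2 / 2 * pdx P (pdx P f) x y t + a * b * pdx P (pdy P f) x y t
     + b\<^sup>2 / 2 * pdy P (pdy P f) x y t
     + c * a * pdx P (pdt P f) x y t + c * b * pdy P (pdt P f) x y t
     + a * a * a / 6 * pdx P (pdx P (pdx P f)) x y t
     + a * a * b / 2 * pdx P (pdx P (pdy P f)) x y t
     + a * b * b / 2 * pdx P (pdy P (pdy P f)) x y t
     + b * b * b / 6 * pdy P (pdy P (pdy P f)) x y t"

text \<open>Freezing \<open>t\<close> first, then \<open>y\<close>, then \<open>x\<close>, leaves nine one-variable remainders; each, times
  the increments in front of it, has weight at least four.\<close>

lemma parabolic_taylor:
  assumes f: "bounded_derivs P B 4 f"
    and c0: "in_cyl P x y t" and c1: "in_cyl P (x + a) (y + b) (t + c)"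
    and a: "\<bar>a\<bar> \<le> L" and b: "\<bar>b\<bar> \<le> L" and c: "\<bar>c\<bar> \<le> L\<^sup>2"
  shows "\<bar>f (x + a) (y + b) (t + c) - taylor_poly P f x y t a b c\<bar> \<le> 6 * B * L ^ 4"
proof -
  have B: "0 \<le> B" using bounded_derivs_abs_le[OF f c0] by linarith
  have cyl: "in_cyl P (x + a) (y + b) t" "in_cyl P (x + a) y t"
    using c0 c1 by (auto simp: in_cyl_def)
  have f4: "bounded_derivs P B (Suc (Suc (Suc (Suc 0)))) f"
    using f by (simp add: eval_nat_numeral del: bounded_derivs.simps)
  have fam:
    "bounded_derivs P B (Suc 1) f" "bounded_derivs P B (Suc 1) (pdt P f)"
    "bounded_derivs P B (Suc 0) (pdy P (pdt P f))"
    "bounded_derivs P B (Suc 3) f" "bounded_derivs P B (Suc 2) (pdy P f)"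
    "bounded_derivs P B (Suc 1) (pdy P (pdy P f))"
    "bounded_derivs P B (Suc 0) (pdy P (pdy P (pdy P f)))"
    by (rule bounded_derivs_lower_order, ((rule bounded_derivs_partials)+)?, rule f4, simp)+
  have pw: "\<bar>a\<bar> ^ m \<le> L ^ m" "\<bar>b\<bar> ^ m \<le> L ^ m" for m
    using a b by (auto intro: power_mono)
  have Tt: "\<bar>g x' y' (t + c) - g x' y' t - c * pdt P g x' y' t\<bar> \<le> B * L ^ 4"
    if "bounded_derivs P B (Suc 1) g" "in_cyl P x' y' t" "in_cyl P x' y' (t + c)" for g x' y'
  proof -
    have "\<bar>c\<bar> ^ 2 \<le> (L\<^sup>2) ^ 2" using c by (intro power_mono) auto
    then have "B * \<bar>c\<bar> ^ 2 \<le> B * L ^ 4" using B by (simp add: mult_left_mono)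
    moreover have "\<bar>g x' y' (t + c) - g x' y' t - c * pdt P g x' y' t\<bar> \<le> B * \<bar>c\<bar> ^ 2"
      using taylor_t[OF that] by (simp add: algebra_simps numeral_2_eq_2)
    ultimately show ?thesis by linarith
  qed
  define R1 where "R1 = f (x + a) (y + b) (t + c) - f (x + a) (y + b) t
      - c * pdt P f (x + a) (y + b) t"
  define R2 where "R2 = pdt P f (x + a) (y + b) t - pdt P f (x + a) y t
      - b * pdy P (pdt P f) (x + a) y t"
  define R3 where "R3 = pdt P f (x + a) y t - pdt P f x y t - a * pdx P (pdt P f) x y t"
  define R4 where "R4 = pdy P (pdt P f) (x + a) y t - pdy P (pdt P f) x y t"
  define R5 where "R5 = f (x + a) (y + b) t - f (x + a) y t - b * pdy P f (x + a) y t
      - b\<^sup>2 / 2 * pdy P (pdy P f) (x + a) y t - b * b * b / 6 * pdy P (pdy P (pdy P f)) (x + a) y t"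
  define R6 where "R6 = f (x + a) y t - f x y t - a * pdx P f x y t
      - a\<^sup>2 / 2 * pdx P (pdx P f) x y t - a * a * a / 6 * pdx P (pdx P (pdx P f)) x y t"
  define R7 where "R7 = pdy P f (x + a) y t - pdy P f x y t - a * pdx P (pdy P f) x y t
      - a\<^sup>2 / 2 * pdx P (pdx P (pdy P f)) x y t"
  define R8 where "R8 = pdy P (pdy P f) (x + a) y t - pdy P (pdy P f) x y t
      - a * pdx P (pdy P (pdy P f)) x y t"
  define R9 where "R9 = pdy P (pdy P (pdy P f)) (x + a) y t - pdy P (pdy P (pdy P f)) x y t"
  have split: "f (x + a) (y + b) (t + c) - taylor_poly P f x y t a b c
      = R1 + c * R2 + c * R3 + c * b * R4 + R5 + R6 + b * R7 + b\<^sup>2 / 2 * R8 + b * b * b / 6 * R9"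
    unfolding R1_def R2_def R3_def R4_def R5_def R6_def R7_def R8_def R9_def taylor_poly_def
    by (simp add: algebra_simps power2_eq_square)
  note sums = numeral_eq_Suc atMost_Suc algebra_simps
  have "\<bar>R1\<bar> \<le> B * L ^ 4"
    unfolding R1_def using fam(1) cyl(1) c1 by (rule Tt)
  moreover have r2: "\<bar>R2\<bar> \<le> B * L ^ 2"
  proof -
    have "\<bar>R2\<bar> \<le> B * \<bar>b\<bar> ^ 2"
      unfolding R2_def using taylor_y[OF fam(2) cyl(2,1)] by (simp add: sums)
    then show ?thesis using mult_left_mono[OF pw(2)[of 2] B] by linarith
  qed
  moreover have r3: "\<bar>R3\<bar> \<le> B * L ^ 2"
  proof -
    have "\<bar>R3\<bar> \<le> B * \<bar>a\<bar> ^ 2"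
      unfolding R3_def using taylor_x[OF fam(2) c0 cyl(2)] by (simp add: sums)
    then show ?thesis using mult_left_mono[OF pw(1)[of 2] B] by linarith
  qed
  moreover have r4: "\<bar>R4\<bar> \<le> B * L"
  proof -
    have "\<bar>R4\<bar> \<le> B * \<bar>a\<bar>"
      unfolding R4_def using taylor_x[OF fam(3) c0 cyl(2)] by simp
    then show ?thesis using mult_left_mono[OF a B] by linarith
  qed
  moreover have r5: "\<bar>R5\<bar> \<le> B * L ^ 4 / 6"
  proof -
    have "\<bar>R5\<bar> \<le> B * \<bar>b\<bar> ^ 4 / 6"
      unfolding R5_def using taylor_y[OF fam(4) cyl(2,1)] by (simp add: sums)
    then show ?thesis using mult_left_mono[OF pw(2)[of 4] B] by linarith
  qed
  moreover have r6: "\<bar>R6\<bar> \<le> B * L ^ 4 / 6"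
  proof -
    have "\<bar>R6\<bar> \<le> B * \<bar>a\<bar> ^ 4 / 6"
      unfolding R6_def using taylor_x[OF fam(4) c0 cyl(2)] by (simp add: sums)
    then show ?thesis using mult_left_mono[OF pw(1)[of 4] B] by linarith
  qed
  moreover have r7: "\<bar>R7\<bar> \<le> B * L ^ 3 / 2"
  proof -
    have "\<bar>R7\<bar> \<le> B * \<bar>a\<bar> ^ 3 / 2"
      unfolding R7_def using taylor_x[OF fam(5) c0 cyl(2)] by (simp add: sums)
    then show ?thesis using mult_left_mono[OF pw(1)[of 3] B] by linarith
  qed
  moreover have r8: "\<bar>R8\<bar> \<le> B * L ^ 2"
  proof -
    have "\<bar>R8\<bar> \<le> B * \<bar>a\<bar> ^ 2"
      unfolding R8_def using taylor_x[OF fam(6) c0 cyl(2)] by (simp add: sums)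
    then show ?thesis using mult_left_mono[OF pw(1)[of 2] B] by linarith
  qed
  moreover have r9: "\<bar>R9\<bar> \<le> B * L"
  proof -
    have "\<bar>R9\<bar> \<le> B * \<bar>a\<bar>"
      unfolding R9_def using taylor_x[OF fam(7) c0 cyl(2)] by simp
    then show ?thesis using mult_left_mono[OF a B] by linarith
  qed
  moreover have "\<bar>c * R2\<bar> \<le> B * L ^ 4" "\<bar>c * R3\<bar> \<le> B * L ^ 4"
    using abs_mult_le[OF c r2] abs_mult_le[OF c r3] by (simp_all add: eval_nat_numeral algebra_simps)
  moreover have "\<bar>c * b * R4\<bar> \<le> B * L ^ 4"
    using abs_mult_le[OF abs_mult_le[OF c b] r4] by (simp add: eval_nat_numeral algebra_simps)
  moreover have "\<bar>b * R7\<bar> \<le> B * L ^ 4 / 2"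
    using abs_mult_le[OF b r7] by (simp add: eval_nat_numeral algebra_simps)
  moreover have "\<bar>b\<^sup>2 / 2 * R8\<bar> \<le> B * L ^ 4 / 2"
    using abs_mult_le[OF abs_mult_le[OF b b] r8] by (simp add: eval_nat_numeral algebra_simps)
  moreover have "\<bar>b * b * b / 6 * R9\<bar> \<le> B * L ^ 4 / 6"
    using abs_mult_le[OF abs_mult_le[OF abs_mult_le[OF b b] b] r9] by (simp add: eval_nat_numeral algebra_simps)
  moreover have "0 \<le> B * L ^ 4" using B by simp
  \<comment> \<open>The coefficients of \<open>B * L ^ 4\<close> add up to \<open>11/2\<close>.\<close>
  ultimately show ?thesis unfolding split abs_le_iff by linarith
qed

section \<open>Consistency of the four branches\<close>

text \<open>In a product of three factors the antithetic average keeps only the terms with an even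
  number of diffusive increments \<open>e\<close>. Each of those contains at least one drift increment
  \<open>r = O(u\<^sup>2)\<close>, which makes a cubic moment of order \<open>u ^ 4\<close> instead of \<open>u ^ 3\<close>.\<close>

lemma antithetic_cubic_bound:
  fixes r1 r2 r3 e1 e2 e3 K u T :: real
  assumes r: "\<bar>r1\<bar> \<le> K * u\<^sup>2" "\<bar>r2\<bar> \<le> K * u\<^sup>2" "\<bar>r3\<bar> \<le> K * u\<^sup>2"
    and e: "\<bar>e1\<bar> \<le> K * u" "\<bar>e2\<bar> \<le> K * u" "\<bar>e3\<bar> \<le> K * u"
    and "0 \<le> K" and "u\<^sup>2 \<le> T"
  shows "\<bar>(r1 + e1) * (r2 + e2) * (r3 + e3) + (r1 - e1) * (r2 - e2) * (r3 - e3)\<bar>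
           \<le> 2 * K ^ 3 * (T + 3) * u ^ 4"
proof -
  have eq: "(r1 + e1) * (r2 + e2) * (r3 + e3) + (r1 - e1) * (r2 - e2) * (r3 - e3)
      = 2 * (r1 * r2 * r3) + 2 * (r1 * e2 * e3) + 2 * (e1 * r2 * e3) + 2 * (e1 * e2 * r3)"
    by (simp add: algebra_simps)
  have "\<bar>r1 * r2 * r3\<bar> \<le> K * u\<^sup>2 * (K * u\<^sup>2) * (K * u\<^sup>2)"
    by (intro abs_mult_le r)
  also have "\<dots> = K ^ 3 * u ^ 4 * u\<^sup>2" by (simp add: eval_nat_numeral)
  also have "\<dots> \<le> K ^ 3 * u ^ 4 * T"
    using assms(7,8) by (intro mult_left_mono) auto
  finally have r3: "\<bar>r1 * r2 * r3\<bar> \<le> K ^ 3 * u ^ 4 * T" .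
  have "\<bar>r1 * e2 * e3\<bar> \<le> K * u\<^sup>2 * (K * u) * (K * u)"
       "\<bar>e1 * r2 * e3\<bar> \<le> K * u * (K * u\<^sup>2) * (K * u)"
       "\<bar>e1 * e2 * r3\<bar> \<le> K * u * (K * u) * (K * u\<^sup>2)"
    by (intro abs_mult_le r e)+
  then have mixed: "\<bar>r1 * e2 * e3\<bar> \<le> K ^ 3 * u ^ 4" "\<bar>e1 * r2 * e3\<bar> \<le> K ^ 3 * u ^ 4"
       "\<bar>e1 * e2 * r3\<bar> \<le> K ^ 3 * u ^ 4"
    by (simp_all add: eval_nat_numeral algebra_simps)
  have "2 * K ^ 3 * (T + 3) * u ^ 4 = 2 * (K ^ 3 * u ^ 4 * T) + 6 * (K ^ 3 * u ^ 4)"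
    by (simp add: algebra_simps)
  then show ?thesis
    unfolding eq using r3 mixed unfolding abs_le_iff by linarith
qed

text \<open>Two branches with the same drift \<open>r\<close> and opposite diffusive increments \<open>\<plusminus> e\<close>, of sizes
  \<open>u\<^sup>2\<close> and \<open>u\<close> where \<open>u\<close> is the square root of the elapsed time: the terms of odd order in \<open>u\<close>
  cancel in the sum, so that the error is of order \<open>u ^ 4\<close> once those of order \<open>u\<^sup>2\<close> are kept.\<close>

lemma taylor_poly_antithetic:
  assumes f: "bounded_derivs P B 4 f" and cyl: "in_cyl P x y t"
    and r: "\<bar>r1\<bar> \<le> K * u\<^sup>2" "\<bar>r2\<bar> \<le> K * u\<^sup>2"
    and e: "\<bar>e1\<bar> \<le> K * u" "\<bar>e2\<bar> \<le> K * u"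
    and K: "0 \<le> K" and uT: "u\<^sup>2 \<le> T"
  shows "\<bar>taylor_poly P f x y t (r1 + e1) (r2 + e2) (u\<^sup>2)
          + taylor_poly P f x y t (r1 - e1) (r2 - e2) (u\<^sup>2)
          - (2 * (f x y t + u\<^sup>2 * pdt P f x y t + r1 * pdx P f x y t + r2 * pdy P f x y t)
             + e1\<^sup>2 * pdx P (pdx P f) x y t + 2 * e1 * e2 * pdx P (pdy P f) x y t
             + e2\<^sup>2 * pdy P (pdy P f) x y t)\<bar>
         \<le> (4 * K\<^sup>2 + 4 * K + 3 * K ^ 3 * (T + 3)) * B * u ^ 4"
proof -
  define F where "F = f x y t"
  define Ft where "Ft = pdt P f x y t"
  define Fx where "Fx = pdx P f x y t"
  define Fy where "Fy = pdy P f x y t"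
  define Fxx where "Fxx = pdx P (pdx P f) x y t"
  define Fxy where "Fxy = pdx P (pdy P f) x y t"
  define Fyy where "Fyy = pdy P (pdy P f) x y t"
  define Fxt where "Fxt = pdx P (pdt P f) x y t"
  define Fyt where "Fyt = pdy P (pdt P f) x y t"
  define Fxxx where "Fxxx = pdx P (pdx P (pdx P f)) x y t"
  define Fxxy where "Fxxy = pdx P (pdx P (pdy P f)) x y t"
  define Fxyy where "Fxyy = pdx P (pdy P (pdy P f)) x y t"
  define Fyyy where "Fyyy = pdy P (pdy P (pdy P f)) x y t"
  note names = F_def Ft_def Fx_def Fy_def Fxx_def Fxy_def Fyy_def Fxt_def Fyt_def
    Fxxx_def Fxxy_def Fxyy_def Fyyy_def
  have f4: "bounded_derivs P B (Suc (Suc (Suc (Suc 0)))) f"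
    using f by (simp add: eval_nat_numeral del: bounded_derivs.simps)
  have bd: "\<bar>Fxx\<bar> \<le> B" "\<bar>Fxy\<bar> \<le> B" "\<bar>Fyy\<bar> \<le> B" "\<bar>Fxt\<bar> \<le> B" "\<bar>Fyt\<bar> \<le> B"
    "\<bar>Fxxx\<bar> \<le> B" "\<bar>Fxxy\<bar> \<le> B" "\<bar>Fxyy\<bar> \<le> B" "\<bar>Fyyy\<bar> \<le> B"
    unfolding names by (rule bounded_derivs_abs_le[OF _ cyl], (rule bounded_derivs_partials)+, rule f4)+
  have B: "0 \<le> B" using bd(1) by linarith
  define S where "S p1 q1 p2 q2 p3 q3 =
      (p1 + q1) * (p2 + q2) * (p3 + q3) + (p1 - q1) * (p2 - q2) * (p3 - q3)"
    for p1 q1 p2 q2 p3 q3 :: real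
  define V where "V = 2 * K ^ 3 * (T + 3) * u ^ 4"
  have S: "\<bar>S r1 e1 r1 e1 r1 e1 * Fxxx\<bar> \<le> V * B" "\<bar>S r1 e1 r1 e1 r2 e2 * Fxxy\<bar> \<le> V * B"
    "\<bar>S r1 e1 r2 e2 r2 e2 * Fxyy\<bar> \<le> V * B" "\<bar>S r2 e2 r2 e2 r2 e2 * Fyyy\<bar> \<le> V * B"
    unfolding S_def V_def by (intro abs_mult_le antithetic_cubic_bound r e K uT bd)+
  have quad: "\<bar>r1 * r1 * Fxx\<bar> \<le> K * u\<^sup>2 * (K * u\<^sup>2) * B"
    "\<bar>r1 * r2 * Fxy\<bar> \<le> K * u\<^sup>2 * (K * u\<^sup>2) * B" "\<bar>r2 * r2 * Fyy\<bar> \<le> K * u\<^sup>2 * (K * u\<^sup>2) * B"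
    by (intro abs_mult_le r bd)+
  have uu: "\<bar>u\<^sup>2\<bar> \<le> u\<^sup>2" by simp
  have mix: "\<bar>u\<^sup>2 * r1 * Fxt\<bar> \<le> u\<^sup>2 * (K * u\<^sup>2) * B" "\<bar>u\<^sup>2 * r2 * Fyt\<bar> \<le> u\<^sup>2 * (K * u\<^sup>2) * B"
    by (intro abs_mult_le uu r bd)+
  have "taylor_poly P f x y t (r1 + e1) (r2 + e2) (u\<^sup>2)
          + taylor_poly P f x y t (r1 - e1) (r2 - e2) (u\<^sup>2)
          - (2 * (F + u\<^sup>2 * Ft + r1 * Fx + r2 * Fy)
             + e1\<^sup>2 * Fxx + 2 * e1 * e2 * Fxy + e2\<^sup>2 * Fyy)
      = r1 * r1 * Fxx + 2 * (r1 * r2 * Fxy) + r2 * r2 * Fyy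
        + 2 * (u\<^sup>2 * r1 * Fxt) + 2 * (u\<^sup>2 * r2 * Fyt)
        + S r1 e1 r1 e1 r1 e1 * Fxxx / 6 + S r1 e1 r1 e1 r2 e2 * Fxxy / 2
        + S r1 e1 r2 e2 r2 e2 * Fxyy / 2 + S r2 e2 r2 e2 r2 e2 * Fyyy / 6"
    unfolding taylor_poly_def names[symmetric] S_def
    by (simp add: algebra_simps power2_eq_square add_divide_distrib diff_divide_distrib)
  moreover have "\<bar>\<dots>\<bar> \<le> 4 * (K * u\<^sup>2 * (K * u\<^sup>2) * B) + 4 * (u\<^sup>2 * (K * u\<^sup>2) * B) + 4 / 3 * (V * B)"
    using S quad mix unfolding abs_le_iff by linarith
  moreover have "\<dots> \<le> (4 * K\<^sup>2 + 4 * K + 3 * K ^ 3 * (T + 3)) * B * u ^ 4"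
  proof -
    have "0 \<le> T" using uT zero_le_power2[of u] by linarith
    then have "0 \<le> V * B" using B K unfolding V_def by simp
    moreover have "(4 * K\<^sup>2 + 4 * K + 3 * K ^ 3 * (T + 3)) * B * u ^ 4
        = 4 * (K * u\<^sup>2 * (K * u\<^sup>2) * B) + 4 * (u\<^sup>2 * (K * u\<^sup>2) * B) + 3 / 2 * (V * B)"
      unfolding V_def by (simp add: eval_nat_numeral algebra_simps)
    ultimately show ?thesis by linarith
  qed
  ultimately show ?thesis unfolding names by linarith
qed

text \<open>These identities give the four branches the covariance of the diffusion: they produce the
  coefficients of \<open>\<partial>\<^sub>x\<^sub>x\<close>, \<open>\<partial>\<^sub>y\<^sub>y\<close> (the sum) and of \<open>\<partial>\<^sub>x\<^sub>y\<close> (the difference).\<close>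

lemma alpha_beta_moments:
  assumes "rho P x y t \<in> {-1..1}"
  shows "(alpha P x y t)\<^sup>2 + (beta P x y t)\<^sup>2 = 2"
    and "(alpha P x y t)\<^sup>2 - (beta P x y t)\<^sup>2 = 2 * rho P x y t"
    and "\<bar>alpha P x y t\<bar> \<le> 2" and "\<bar>beta P x y t\<bar> \<le> 2"
proof -
  define th where "th = theta P x y t"
  have one: "(sin th)\<^sup>2 + (cos th)\<^sup>2 = 1" by simp
  have ab: "alpha P x y t = sin th + cos th" "beta P x y t = sin th - cos th"
    by (simp_all add: alpha_def beta_def th_def)
  have "sin (2 * th) = rho P x y t"
    using assms by (simp add: th_def theta_def)
  then have sc: "2 * sin th * cos th = rho P x y t" by (simp add: sin_double)
  show "(alpha P x y t)\<^sup>2 + (beta P x y t)\<^sup>2 = 2"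
    unfolding ab using one by (simp add: power2_eq_square algebra_simps)
  show "(alpha P x y t)\<^sup>2 - (beta P x y t)\<^sup>2 = 2 * rho P x y t"
    unfolding ab using sc by (simp add: power2_eq_square algebra_simps)
  have "\<bar>sin th\<bar> \<le> 1" "\<bar>cos th\<bar> \<le> 1" by auto
  then show "\<bar>alpha P x y t\<bar> \<le> 2" "\<bar>beta P x y t\<bar> \<le> 2"
    unfolding ab by linarith+
qed

definition branch_dx :: "problem \<Rightarrow> real \<Rightarrow> real \<Rightarrow> real \<Rightarrow> nat \<Rightarrow> real \<Rightarrow> real" where
  "branch_dx P x y t k d = drift1 P x y t * d
     + fst (branch_dir (alpha P x y t) (beta P x y t) k) * sigma1 P x y t * sqrt d"

definition branch_dy :: "problem \<Rightarrow> real \<Rightarrow> real \<Rightarrow> real \<Rightarrow> nat \<Rightarrow> real \<Rightarrow> real" where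
  "branch_dy P x y t k d = drift2 P x y t * d
     + snd (branch_dir (alpha P x y t) (beta P x y t) k) * sigma2 P x y t * sqrt d"

text \<open>Branches 1, 3 and branches 2, 4 form antithetic pairs. Their sums combine to
  \<open>4 * (f + d * A f)\<close> up to \<open>O(d\<^sup>2)\<close>, where \<open>A\<close> is the time derivative plus the generator, and
  the differential equation says \<open>A f = r * f\<close>. The factor \<open>2\<close> in the bounds on the volatilities
  absorbs \<open>\<bar>\<alpha>\<bar>, \<bar>\<beta>\<bar> \<le> 2\<close>. Only the endpoints of the branches must lie in the cylinder: the
  cylinder is a box, so the corners of the path along the coordinate directions lie in it too.\<close>

lemma branches_consistent:
  assumes adm: "admissible P" and pde: "solves_pde P f"
    and f: "bounded_derivs P B 4 f"
    and xy: "(x, y) \<in> Omega P" and t: "t \<in> {0..<horizon P}"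
    and drift: "\<bar>drift1 P x y t\<bar> \<le> K" "\<bar>drift2 P x y t\<bar> \<le> K"
    and sigma: "2 * \<bar>sigma1 P x y t\<bar> \<le> K" "2 * \<bar>sigma2 P x y t\<bar> \<le> K"
    and K: "1 \<le> K" and d: "0 \<le> d" "d \<le> T"
    and cyl: "\<And>k. k \<in> {1..4} \<Longrightarrow>
                in_cyl P (x + branch_dx P x y t k d) (y + branch_dy P x y t k d) (t + d)"
  shows "\<bar>(\<Sum>k = 1..4. f (x + branch_dx P x y t k d) (y + branch_dy P x y t k d) (t + d))
            - 4 * (1 + rate P x y t * d) * f x y t\<bar>
          \<le> (24 * (K * (1 + sqrt T)) ^ 4 + 2 * (4 * K\<^sup>2 + 4 * K + 3 * K ^ 3 * (T + 3))) * B * d\<^sup>2"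
proof -
  define u where "u = sqrt d"
  have u: "0 \<le> u" "u\<^sup>2 = d" "u \<le> sqrt T" using d by (auto simp: u_def)
  define D where "D = 4 * K\<^sup>2 + 4 * K + 3 * K ^ 3 * (T + 3)"
  define al be where "al = alpha P x y t" and "be = beta P x y t"
  define s1 s2 where "s1 = sigma1 P x y t" and "s2 = sigma2 P x y t"
  define r1 r2 where "r1 = drift1 P x y t * d" and "r2 = drift2 P x y t * d"
  define g where "g k = f (x + branch_dx P x y t k d) (y + branch_dy P x y t k d) (t + d)" for k
  define p where "p a b = taylor_poly P f x y t a b (u\<^sup>2)" for a b
  have c0: "in_cyl P x y t"
    using xy t by (auto simp: Omega_def in_cyl_def)
  have rho: "rho P x y t \<in> {-1..1}"
    using adm xy t unfolding admissible_def by blast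
  note ab = alpha_beta_moments[OF rho, folded al_def be_def]
  have r: "\<bar>r1\<bar> \<le> K * u\<^sup>2" "\<bar>r2\<bar> \<le> K * u\<^sup>2"
    using drift d u by (auto simp: r1_def r2_def abs_mult intro!: mult_right_mono)
  have e: "\<bar>c * s1 * u\<bar> \<le> K * u" "\<bar>c * s2 * u\<bar> \<le> K * u" if "\<bar>c\<bar> \<le> 2" for c
  proof -
    have "\<bar>c * s1\<bar> \<le> 2 * \<bar>s1\<bar>" "\<bar>c * s2\<bar> \<le> 2 * \<bar>s2\<bar>"
      using that by (auto simp: abs_mult intro!: mult_right_mono)
    then have "\<bar>c * s1\<bar> \<le> K" "\<bar>c * s2\<bar> \<le> K"
      using sigma by (auto simp: s1_def s2_def)
    then show "\<bar>c * s1 * u\<bar> \<le> K * u" "\<bar>c * s2 * u\<bar> \<le> K * u"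
      using u(1) by (auto simp: abs_mult intro!: mult_right_mono)
  qed
  have L: "\<bar>r + q\<bar> \<le> K * (1 + sqrt T) * u" if "\<bar>r\<bar> \<le> K * u\<^sup>2" "\<bar>q\<bar> \<le> K * u" for r q
  proof -
    have "K * u * u \<le> K * u * sqrt T" using u K by (intro mult_left_mono) auto
    then show ?thesis using that by (simp add: algebra_simps power2_eq_square)
  qed
  have cL: "\<bar>u\<^sup>2\<bar> \<le> (K * (1 + sqrt T) * u)\<^sup>2"
  proof -
    have "1 * 1 \<le> K * (1 + sqrt T)" using K d by (intro mult_mono) auto
    then have "1 * u \<le> K * (1 + sqrt T) * u" using u by (intro mult_right_mono) auto
    then have "(1 * u)\<^sup>2 \<le> (K * (1 + sqrt T) * u)\<^sup>2" using u by (intro power_mono) auto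
    then show ?thesis by simp
  qed
  have approx: "\<bar>g k - p (r1 + q1) (r2 + q2)\<bar> \<le> 6 * B * (K * (1 + sqrt T)) ^ 4 * u ^ 4"
    if k: "k \<in> {1..4}"
      and q: "branch_dx P x y t k d = r1 + q1" "branch_dy P x y t k d = r2 + q2"
        "\<bar>q1\<bar> \<le> K * u" "\<bar>q2\<bar> \<le> K * u" for k q1 q2
  proof -
    have "\<bar>f (x + (r1 + q1)) (y + (r2 + q2)) (t + u\<^sup>2) - taylor_poly P f x y t (r1 + q1) (r2 + q2) (u\<^sup>2)\<bar>
            \<le> 6 * B * (K * (1 + sqrt T) * u) ^ 4"
      using cyl[OF k] L[OF r(1) q(3)] L[OF r(2) q(4)] cL
      by (intro parabolic_taylor f c0) (simp_all add: q u)
    then show ?thesis by (simp add: g_def p_def q u power_mult_distrib mult.assoc)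
  qed
  have dirs: "branch_dx P x y t 1 d = r1 + al * s1 * u" "branch_dy P x y t 1 d = r2 + al * s2 * u"
    "branch_dx P x y t 2 d = r1 + (- be) * s1 * u" "branch_dy P x y t 2 d = r2 + be * s2 * u"
    "branch_dx P x y t 3 d = r1 + (- al) * s1 * u" "branch_dy P x y t 3 d = r2 + (- al) * s2 * u"
    "branch_dx P x y t 4 d = r1 + be * s1 * u" "branch_dy P x y t 4 d = r2 + (- be) * s2 * u"
    by (simp_all add: branch_dx_def branch_dy_def branch_dir_def al_def be_def s1_def s2_def
        r1_def r2_def u_def)
  have neg: "\<bar>- al\<bar> \<le> 2" "\<bar>- be\<bar> \<le> 2" using ab by auto
  have g1: "\<bar>g 1 - p (r1 + al * s1 * u) (r2 + al * s2 * u)\<bar> \<le> 6 * B * (K * (1 + sqrt T)) ^ 4 * u ^ 4"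
    using dirs e[OF ab(3)] by (intro approx) auto
  have g2: "\<bar>g 2 - p (r1 + (- be) * s1 * u) (r2 + be * s2 * u)\<bar> \<le> 6 * B * (K * (1 + sqrt T)) ^ 4 * u ^ 4"
    using dirs e[OF ab(4)] e[OF neg(2)] by (intro approx) auto
  have g3: "\<bar>g 3 - p (r1 + (- al) * s1 * u) (r2 + (- al) * s2 * u)\<bar> \<le> 6 * B * (K * (1 + sqrt T)) ^ 4 * u ^ 4"
    using dirs e[OF neg(1)] by (intro approx) auto
  have g4: "\<bar>g 4 - p (r1 + be * s1 * u) (r2 + (- be) * s2 * u)\<bar> \<le> 6 * B * (K * (1 + sqrt T)) ^ 4 * u ^ 4"
    using dirs e[OF ab(4)] e[OF neg(2)] by (intro approx) auto
  \<comment> \<open>\<open>A0 + Q e1 e2\<close> is the part of an antithetic pair that survives.\<close>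
  define A0 where "A0 = 2 * (f x y t + u\<^sup>2 * pdt P f x y t + r1 * pdx P f x y t + r2 * pdy P f x y t)"
  define Q where "Q e1 e2 = e1\<^sup>2 * pdx P (pdx P f) x y t + 2 * e1 * e2 * pdx P (pdy P f) x y t
             + e2\<^sup>2 * pdy P (pdy P f) x y t" for e1 e2
  have anti: "\<bar>p (r1 + q1) (r2 + q2) + p (r1 - q1) (r2 - q2) - (A0 + Q q1 q2)\<bar> \<le> D * B * u ^ 4"
    if "\<bar>q1\<bar> \<le> K * u" "\<bar>q2\<bar> \<le> K * u" for q1 q2
    using taylor_poly_antithetic[OF f c0 r that, of T] K d u
    by (simp add: p_def A0_def Q_def D_def algebra_simps)
  have anti13: "\<bar>p (r1 + al * s1 * u) (r2 + al * s2 * u) + p (r1 + (- al) * s1 * u) (r2 + (- al) * s2 * u)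
      - (A0 + Q (al * s1 * u) (al * s2 * u))\<bar> \<le> D * B * u ^ 4"
    using anti[OF e[OF ab(3)]] by simp
  have anti24: "\<bar>p (r1 + be * s1 * u) (r2 + (- be) * s2 * u) + p (r1 + (- be) * s1 * u) (r2 + be * s2 * u)
      - (A0 + Q (be * s1 * u) ((- be) * s2 * u))\<bar> \<le> D * B * u ^ 4"
    using anti[OF e(1)[OF ab(4)] e(2)[OF neg(2)]] by simp
  have "Q (al * s1 * u) (al * s2 * u) + Q (be * s1 * u) ((- be) * s2 * u)
      = u\<^sup>2 * ((al\<^sup>2 + be\<^sup>2) * s1\<^sup>2 * pdx P (pdx P f) x y t
          + 2 * (al\<^sup>2 - be\<^sup>2) * s1 * s2 * pdx P (pdy P f) x y t
          + (al\<^sup>2 + be\<^sup>2) * s2\<^sup>2 * pdy P (pdy P f) x y t)"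
    unfolding Q_def by (simp add: algebra_simps power2_eq_square)
  also have "\<dots> = u\<^sup>2 * (2 * s1\<^sup>2 * pdx P (pdx P f) x y t
          + 4 * rho P x y t * s1 * s2 * pdx P (pdy P f) x y t + 2 * s2\<^sup>2 * pdy P (pdy P f) x y t)"
    unfolding ab by simp
  finally have QQ: "Q (al * s1 * u) (al * s2 * u) + Q (be * s1 * u) ((- be) * s2 * u) = \<dots>" .
  have "pdt P f x y t
        + 1/2 * s1\<^sup>2 * pdx P (pdx P f) x y t
        + rho P x y t * s1 * s2 * pdx P (pdy P f) x y t
        + 1/2 * s2\<^sup>2 * pdy P (pdy P f) x y t
        + drift1 P x y t * pdx P f x y t
        + drift2 P x y t * pdy P f x y t
        - rate P x y t * f x y t = 0"
    using pde xy t unfolding solves_pde_def s1_def s2_def by blast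
  then have "rate P x y t * f x y t = pdt P f x y t
        + 1/2 * s1\<^sup>2 * pdx P (pdx P f) x y t
        + rho P x y t * s1 * s2 * pdx P (pdy P f) x y t
        + 1/2 * s2\<^sup>2 * pdy P (pdy P f) x y t
        + drift1 P x y t * pdx P f x y t
        + drift2 P x y t * pdy P f x y t"
    by linarith
  then have "4 * f x y t + 4 * u\<^sup>2 * (rate P x y t * f x y t) = A0 + A0
      + (Q (al * s1 * u) (al * s2 * u) + Q (be * s1 * u) ((- be) * s2 * u))"
    unfolding QQ A0_def r1_def r2_def u(2) by (simp add: algebra_simps)
  then have main: "4 * (1 + rate P x y t * d) * f x y t = A0 + A0
      + (Q (al * s1 * u) (al * s2 * u) + Q (be * s1 * u) ((- be) * s2 * u))"
    unfolding u(2) by (simp add: algebra_simps)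
  have sum4: "(\<Sum>k = 1..4. g k) = g 1 + g 2 + g 3 + g 4"
    by (simp add: numeral_eq_Suc)
  have u4: "u ^ 4 = d\<^sup>2"
    using u(2) by (metis mult_2 numeral_Bit0 power2_eq_square power_add)
  have "\<bar>(\<Sum>k = 1..4. g k) - 4 * (1 + rate P x y t * d) * f x y t\<bar>
      \<le> 4 * (6 * B * (K * (1 + sqrt T)) ^ 4 * u ^ 4) + 2 * (D * B * u ^ 4)"
    unfolding sum4 main using g1 g2 g3 g4 anti13 anti24 unfolding abs_le_iff by linarith
  also have "\<dots> = (24 * (K * (1 + sqrt T)) ^ 4 + 2 * D) * B * d\<^sup>2"
    unfolding u4 by (simp add: algebra_simps)
  finally show ?thesis unfolding D_def g_def .
qed

section \<open>Interpolation on a square grid\<close>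

locale square_grid =
  fixes P :: problem and G :: grid
  assumes adm: "admissible P"
    and M1: "1 \<le> M1 G" and M2: "1 \<le> M2 G" and N: "1 \<le> N G"
    and dt_h1: "dt P G = h1 P G" and h1_h2: "h1 P G = h2 P G"
begin

abbreviation h :: real where "h \<equiv> dt P G"

lemma dt_pos: "0 < h"
  using adm N by (simp add: admissible_def dt_def)

lemma dt_le_horizon: "h \<le> horizon P"
  using adm N by (simp add: admissible_def dt_def field_simps)

lemma end_nodes:
  "xl P + real (M1 G) * h = xr P" "yl P + real (M2 G) * h = yr P" "real (N G) * h = horizon P"
proof -
  show "xl P + real (M1 G) * h = xr P" using M1 by (simp add: dt_h1 h1_def)
  show "yl P + real (M2 G) * h = yr P" using M2 by (simp add: dt_h1 h1_h2 h2_def)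
  show "real (N G) * h = horizon P" using N by (simp add: dt_def)
qed

lemma node_coords: "xn P G i = xl P + real i * h" "yn P G j = yl P + real j * h"
  by (simp_all add: xn_def yn_def dt_h1 h1_h2)

lemma node_in_cyl:
  assumes "i \<le> M1 G" and "j \<le> M2 G" and "n \<le> N G"
  shows "in_cyl P (xn P G i) (yn P G j) (tn P G n)"
proof -
  have "real i * h \<le> real (M1 G) * h" "real j * h \<le> real (M2 G) * h" "real n * h \<le> real (N G) * h"
    using assms dt_pos by (auto intro!: mult_right_mono)
  moreover have "0 \<le> real i * h" "0 \<le> real j * h" "0 \<le> real n * h"
    using dt_pos by simp_all
  ultimately show ?thesis
    unfolding in_cyl_def node_coords tn_def atLeastAtMost_iff using end_nodes by (intro conjI; linarith)
qed

lemma tn_less_horizon: "n < N G \<Longrightarrow> tn P G n \<in> {0..<horizon P}"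
  using dt_pos by (simp add: tn_def flip: end_nodes(3))

lemma tn_Suc: "tn P G (Suc n) = tn P G n + h"
  by (simp add: tn_def algebra_simps)

lemma interior_node_in_Omega:
  assumes "interior_node G i j"
  shows "(xn P G i, yn P G j) \<in> Omega P"
  using assms dt_pos
  by (simp add: interior_node_def Omega_def node_coords flip: end_nodes)

lemma boundary_node_in_frontier:
  assumes "i \<le> M1 G" and "j \<le> M2 G" and "\<not> interior_node G i j"
  shows "(xn P G i, yn P G j) \<in> frontier (Omega P)"
proof -
  have "i = 0 \<or> i = M1 G \<or> j = 0 \<or> j = M2 G"
    using assms by (auto simp: interior_node_def)
  then have "(xn P G i, yn P G j) \<notin> Omega P"
    using end_nodes by (auto simp: Omega_def node_coords)
  moreover have "(xn P G i, yn P G j) \<in> closure (Omega P)"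
    using node_in_cyl[OF assms(1,2), of 0] by (simp add: closure_Omega[OF adm] in_cyl_def)
  ultimately show ?thesis by (simp add: frontier_Omega)
qed

end

text \<open>The clamped index makes the last cell closed on the right, which is why the weight may
  attain \<open>1\<close>.\<close>

lemma cell_weight:
  fixes z z0 d :: real
  assumes "1 \<le> M" and d: "0 < d" and z: "z0 \<le> z" "z \<le> z0 + real M * d"
  shows "Suc (cell z0 d M z) \<le> M"
    and "0 \<le> (z - (z0 + real (cell z0 d M z) * d)) / d"
    and "(z - (z0 + real (cell z0 d M z) * d)) / d \<le> 1"
proof -
  define w where "w = (z - z0) / d"
  have w: "0 \<le> w" "w \<le> real M" using z d by (simp_all add: w_def field_simps)
  have eq: "(z - (z0 + real (cell z0 d M z) * d)) / d = w - real (cell z0 d M z)"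
    using d by (simp add: w_def field_simps)
  have c: "cell z0 d M z = min (nat \<lfloor>w\<rfloor>) (M - 1)" by (simp add: cell_def w_def)
  show "Suc (cell z0 d M z) \<le> M" using assms(1) by (simp add: c)
  have "real (nat \<lfloor>w\<rfloor>) \<le> w" "w < real (nat \<lfloor>w\<rfloor>) + 1" using w by linarith+
  then have "real (cell z0 d M z) \<le> w" "w \<le> real (cell z0 d M z) + 1"
    unfolding c using w(2) assms(1) by (auto simp: min_def of_nat_diff)
  then show "0 \<le> (z - (z0 + real (cell z0 d M z) * d)) / d"
      "(z - (z0 + real (cell z0 d M z) * d)) / d \<le> 1"
    unfolding eq by linarith+
qed

text \<open>The two first-order terms cancel because the weights reproduce \<open>z\<close>.\<close>

lemma linear_interpolation_error:
  fixes \<phi> :: "real \<Rightarrow> real"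
  assumes u: "0 \<le> u" "u \<le> 1" and p: "z = p + u * d" and B: "0 \<le> B"
    and e0: "\<bar>\<phi> p - \<phi> z - D * (p - z)\<bar> \<le> B * \<bar>p - z\<bar>\<^sup>2"
    and e1: "\<bar>\<phi> (p + d) - \<phi> z - D * (p + d - z)\<bar> \<le> B * \<bar>p + d - z\<bar>\<^sup>2"
  shows "\<bar>(1 - u) * \<phi> p + u * \<phi> (p + d) - \<phi> z\<bar> \<le> B * d\<^sup>2"
proof -
  define R0 R1 where "R0 = \<phi> p - \<phi> z - D * (p - z)" and "R1 = \<phi> (p + d) - \<phi> z - D * (p + d - z)"
  have "\<bar>p - z\<bar>\<^sup>2 = u\<^sup>2 * d\<^sup>2" "\<bar>p + d - z\<bar>\<^sup>2 = (1 - u)\<^sup>2 * d\<^sup>2"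
    unfolding p by (simp_all add: power2_eq_square algebra_simps)
  moreover have "u\<^sup>2 * d\<^sup>2 \<le> 1 * d\<^sup>2" "(1 - u)\<^sup>2 * d\<^sup>2 \<le> 1 * d\<^sup>2"
    using u by (intro mult_right_mono power_le_one; simp)+
  ultimately have "B * \<bar>p - z\<bar>\<^sup>2 \<le> B * d\<^sup>2" "B * \<bar>p + d - z\<bar>\<^sup>2 \<le> B * d\<^sup>2"
    using B by (auto intro: mult_left_mono)
  then have R: "\<bar>R0\<bar> \<le> B * d\<^sup>2" "\<bar>R1\<bar> \<le> B * d\<^sup>2"
    using e0 e1 by (auto simp: R0_def R1_def)
  have "(1 - u) * \<phi> p + u * \<phi> (p + d) - \<phi> z = (1 - u) * R0 + u * R1"
    unfolding R0_def R1_def p by (simp add: algebra_simps)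
  also have "\<bar>\<dots>\<bar> \<le> (1 - u) * (B * d\<^sup>2) + u * (B * d\<^sup>2)"
    using u R by (intro order_trans[OF abs_triangle_ineq] add_mono) (auto simp: abs_mult intro!: mult_left_mono)
  finally show ?thesis by (simp add: algebra_simps)
qed

lemma convex_combination_abs_le:
  fixes a b E u :: real
  assumes "0 \<le> u" "u \<le> 1" "\<bar>a\<bar> \<le> E" "\<bar>b\<bar> \<le> E"
  shows "\<bar>(1 - u) * a + u * b\<bar> \<le> E"
proof -
  have "\<bar>(1 - u) * a + u * b\<bar> \<le> (1 - u) * E + u * E"
    using assms by (intro order_trans[OF abs_triangle_ineq] add_mono) (auto simp: abs_mult intro!: mult_left_mono)
  then show ?thesis by (simp add: algebra_simps)
qed

lemma bounded_derivs_first_order: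
  assumes "bounded_derivs P B 2 g" and "in_cyl P x y t"
  shows "in_cyl P x' y t \<Longrightarrow> \<bar>g x' y t - g x y t - pdx P g x y t * (x' - x)\<bar> \<le> B * \<bar>x' - x\<bar>\<^sup>2"
    and "in_cyl P x y' t \<Longrightarrow> \<bar>g x y' t - g x y t - pdy P g x y t * (y' - y)\<bar> \<le> B * \<bar>y' - y\<bar>\<^sup>2"
    and "in_cyl P x y t' \<Longrightarrow> \<bar>g x y t' - g x y t - pdt P g x y t * (t' - t)\<bar> \<le> B * \<bar>t' - t\<bar>\<^sup>2"
proof -
  have g: "bounded_derivs P B (Suc 1) g" using assms(1) by (simp add: numeral_2_eq_2)
  show "in_cyl P x' y t \<Longrightarrow> \<bar>g x' y t - g x y t - pdx P g x y t * (x' - x)\<bar> \<le> B * \<bar>x' - x\<bar>\<^sup>2"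
    using taylor_x[OF g assms(2), of x'] by (simp add: numeral_2_eq_2 diff_diff_eq)
  show "in_cyl P x y' t \<Longrightarrow> \<bar>g x y' t - g x y t - pdy P g x y t * (y' - y)\<bar> \<le> B * \<bar>y' - y\<bar>\<^sup>2"
    using taylor_y[OF g assms(2), of y'] by (simp add: numeral_2_eq_2 diff_diff_eq)
  show "in_cyl P x y t' \<Longrightarrow> \<bar>g x y t' - g x y t - pdt P g x y t * (t' - t)\<bar> \<le> B * \<bar>t' - t\<bar>\<^sup>2"
    using taylor_t[OF g assms(2), of t'] by (simp add: numeral_2_eq_2 diff_diff_eq)
qed

context square_grid
begin

text \<open>Interpolating computed values against the exact solution: the weights are convex, so nodal
  errors are not amplified, and interpolating the exact nodal values costs \<open>B * h\<^sup>2\<close> per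
  direction.\<close>

lemma interp_sp_error:
  assumes f: "bounded_derivs P B 2 f" and xy: "(x, y) \<in> closure (Omega P)" and m: "m \<le> N G"
    and E: "\<And>i j. i \<le> M1 G \<Longrightarrow> j \<le> M2 G \<Longrightarrow>
               \<bar>g m i j - f (xn P G i) (yn P G j) (tn P G m)\<bar> \<le> E"
  shows "\<bar>interp_sp P G g m (x, y) - f x y (tn P G m)\<bar> \<le> E + 2 * B * h\<^sup>2"
proof -
  define t where "t = tn P G m"
  define p where "p = cell (xl P) h (M1 G) x"
  define q where "q = cell (yl P) h (M2 G) y"
  define u where "u = (x - xn P G p) / h"
  define v where "v = (y - yn P G q) / h"
  have box: "xl P \<le> x" "x \<le> xl P + real (M1 G) * h" "yl P \<le> y" "y \<le> yl P + real (M2 G) * h"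
    using xy end_nodes by (auto simp: closure_Omega[OF adm])
  note cx = cell_weight[OF M1 dt_pos box(1,2), folded p_def node_coords, folded u_def]
  note cy = cell_weight[OF M2 dt_pos box(3,4), folded q_def node_coords, folded v_def]
  have "0 \<le> h" using dt_pos by simp
  have xeq: "x = xn P G p + u * h" and yeq: "y = yn P G q + v * h"
    using dt_pos by (simp_all add: u_def v_def)
  have step: "xn P G (Suc p) = xn P G p + h" "yn P G (Suc q) = yn P G q + h"
    by (simp_all add: node_coords algebra_simps)
  define e where "e i j = g m i j - f (xn P G i) (yn P G j) t" for i j
  have e: "\<bar>e i j\<bar> \<le> E" if "i \<in> {p, Suc p}" "j \<in> {q, Suc q}" for i j
    using E[of i j] that cx(1) cy(1) by (auto simp: e_def t_def)
  define w where "w j = (1 - u) * e p j + u * e (Suc p) j" for j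
  have w: "\<bar>w j\<bar> \<le> E" if "j \<in> {q, Suc q}" for j
    unfolding w_def using cx e that by (intro convex_combination_abs_le) auto
  have we: "\<bar>(1 - v) * w q + v * w (Suc q)\<bar> \<le> E"
    using cy w by (intro convex_combination_abs_le) auto
  define I where "I j = (1 - u) * f (xn P G p) (yn P G j) t + u * f (xn P G (Suc p)) (yn P G j) t" for j
  have cyl: "in_cyl P x' y' t" if "x' \<in> {x, xn P G p, xn P G (Suc p)}" "y' \<in> {y, yn P G q, yn P G (Suc q)}"
    for x' y'
    using node_in_cyl[of p q m] node_in_cyl[of "Suc p" "Suc q" m] m cx(1) cy(1) xy that
    by (auto simp: in_cyl_def t_def closure_Omega[OF adm])
  have B: "0 \<le> B" using bounded_derivs_abs_le[OF f cyl[of x y]] by auto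
  have Ix: "\<bar>I j - f x (yn P G j) t\<bar> \<le> B * h\<^sup>2" if "j \<in> {q, Suc q}" for j
    unfolding I_def step
  proof (rule linear_interpolation_error[OF cx(2,3) xeq B])
    show "\<bar>f (xn P G p) (yn P G j) t - f x (yn P G j) t - pdx P f x (yn P G j) t * (xn P G p - x)\<bar>
            \<le> B * \<bar>xn P G p - x\<bar>\<^sup>2"
      using that by (intro bounded_derivs_first_order(1) f cyl) auto
    show "\<bar>f (xn P G p + h) (yn P G j) t - f x (yn P G j) t
              - pdx P f x (yn P G j) t * (xn P G p + h - x)\<bar> \<le> B * \<bar>xn P G p + h - x\<bar>\<^sup>2"
      unfolding step[symmetric] using that by (intro bounded_derivs_first_order(1) f cyl) auto
  qed
  have Iy: "\<bar>(1 - v) * f x (yn P G q) t + v * f x (yn P G (Suc q)) t - f x y t\<bar> \<le> B * h\<^sup>2"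
    unfolding step
  proof (rule linear_interpolation_error[OF cy(2,3) yeq B])
    show "\<bar>f x (yn P G q) t - f x y t - pdy P f x y t * (yn P G q - y)\<bar> \<le> B * \<bar>yn P G q - y\<bar>\<^sup>2"
      by (intro bounded_derivs_first_order(2) f cyl) auto
    show "\<bar>f x (yn P G q + h) t - f x y t - pdy P f x y t * (yn P G q + h - y)\<bar>
            \<le> B * \<bar>yn P G q + h - y\<bar>\<^sup>2"
      unfolding step[symmetric] by (intro bounded_derivs_first_order(2) f cyl) auto
  qed
  have Ixy: "\<bar>(1 - v) * (I q - f x (yn P G q) t) + v * (I (Suc q) - f x (yn P G (Suc q)) t)\<bar> \<le> B * h\<^sup>2"
    using cy Ix by (intro convex_combination_abs_le) auto
  have "interp_sp P G g m (x, y)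
      = (1 - u) * (1 - v) * g m p q + u * (1 - v) * g m (Suc p) q
        + (1 - u) * v * g m p (Suc q) + u * v * g m (Suc p) (Suc q)"
    by (simp add: interp_sp_def Let_def p_def q_def u_def v_def flip: dt_h1 h1_h2)
  also have "\<dots> = f x y t + ((1 - v) * w q + v * w (Suc q))
      + ((1 - v) * (I q - f x (yn P G q) t) + v * (I (Suc q) - f x (yn P G (Suc q)) t))
      + ((1 - v) * f x (yn P G q) t + v * f x (yn P G (Suc q)) t - f x y t)"
    unfolding w_def e_def I_def by (simp add: algebra_simps)
  finally show ?thesis
    unfolding t_def[symmetric] using we Ixy Iy by linarith
qed

text \<open>For an early stop the data of both time levels enter, the unknown one included, so the
  nodal error has to be bounded on both; the time direction costs one more \<open>B * h\<^sup>2\<close>.\<close>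

lemma interp_st_error:
  assumes f: "bounded_derivs P B 2 f" and xy: "(x, y) \<in> closure (Omega P)" and n: "n < N G"
    and s: "tn P G n \<le> s" "s \<le> tn P G (Suc n)"
    and E: "\<And>m i j. m \<in> {n, Suc n} \<Longrightarrow> i \<le> M1 G \<Longrightarrow> j \<le> M2 G \<Longrightarrow>
               \<bar>g m i j - f (xn P G i) (yn P G j) (tn P G m)\<bar> \<le> E"
  shows "\<bar>interp_st P G g n (x, y) s - f x y s\<bar> \<le> E + 3 * B * h\<^sup>2"
proof -
  define v where "v = (s - tn P G n) / h"
  have v: "0 \<le> v" "v \<le> 1" "s = tn P G n + v * h"
    using s dt_pos by (simp_all add: v_def tn_Suc field_simps)
  have wgt: "(tn P G (Suc n) - s) / dt P G = 1 - v"
    using dt_pos by (simp add: v_def tn_Suc field_simps)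
  have cyl: "in_cyl P x y r" if "r \<in> {s, tn P G n, tn P G (Suc n)}" for r
    using node_in_cyl[of 0 0 n] node_in_cyl[of 0 0 "Suc n"] n s xy that
    by (auto simp: in_cyl_def closure_Omega[OF adm])
  have B: "0 \<le> B" using bounded_derivs_abs_le[OF f cyl[of s]] by auto
  define I where "I m = interp_sp P G g m (x, y) - f x y (tn P G m)" for m
  have I: "\<bar>(1 - v) * I n + v * I (Suc n)\<bar> \<le> E + 2 * B * h\<^sup>2"
    using v interp_sp_error[OF f xy] n E unfolding I_def
    by (intro convex_combination_abs_le) auto
  have T: "\<bar>(1 - v) * f x y (tn P G n) + v * f x y (tn P G (Suc n)) - f x y s\<bar> \<le> B * h\<^sup>2"
    unfolding tn_Suc
  proof (rule linear_interpolation_error[OF v B])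
    show "\<bar>f x y (tn P G n) - f x y s - pdt P f x y s * (tn P G n - s)\<bar>
            \<le> B * \<bar>tn P G n - s\<bar>\<^sup>2"
      by (intro bounded_derivs_first_order(3) f cyl) auto
    show "\<bar>f x y (tn P G n + h) - f x y s - pdt P f x y s * (tn P G n + h - s)\<bar>
            \<le> B * \<bar>tn P G n + h - s\<bar>\<^sup>2"
      unfolding tn_Suc[symmetric] by (intro bounded_derivs_first_order(3) f cyl) auto
  qed
  have "interp_st P G g n (x, y) s = f x y s + ((1 - v) * I n + v * I (Suc n))
      + ((1 - v) * f x y (tn P G n) + v * f x y (tn P G (Suc n)) - f x y s)"
    unfolding interp_st_def wgt v_def[symmetric] I_def by (simp add: algebra_simps)
  then show ?thesis using I T by linarith
qed

end

section \<open>The uniform stopping time\<close>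

lemma branch_eq:
  "branch P G i j n k s =
     (xn P G i + branch_dx P (xn P G i) (yn P G j) (tn P G n) k (s - tn P G n),
      yn P G j + branch_dy P (xn P G i) (yn P G j) (tn P G n) k (s - tn P G n))"
  by (simp add: branch_def branch_dx_def branch_dy_def Let_def add.assoc)

lemma continuous_on_branch: "continuous_on A (branch P G i j n k)"
  unfolding branch_def Let_def by (intro continuous_intros)

lemma tau_in_branch_exit_times:
  "\<exists>k \<in> {1..4}. tau P G i j n = tau_k P G i j n k"
proof -
  have "tau P G i j n \<in> tau_k P G i j n ` {1..4}"
    unfolding tau_def by (intro Min_in) auto
  then show ?thesis by auto
qed

context square_grid
begin

text \<open>The exit times of a continuous path from an open set form a closed set, so the infimum is
  attained.\<close>

lemma tau_k_attained:
  "tau_k P G i j n k \<in>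
     insert (tn P G (Suc n)) {s. tn P G n \<le> s \<and> branch P G i j n k s \<notin> Omega P}"
  unfolding tau_k_def
proof (rule closed_contains_Inf)
  show "bdd_below (insert (tn P G (Suc n)) {s. tn P G n \<le> s \<and> branch P G i j n k s \<notin> Omega P})"
    using dt_pos by (intro bdd_belowI[of _ "tn P G n"]) (auto simp: tn_Suc)
  have "closed ({tn P G n..} \<inter> branch P G i j n k -` (- Omega P))"
    by (intro continuous_closed_preimage continuous_on_branch) (auto simp: open_Omega closed_Compl)
  moreover have "{tn P G n..} \<inter> branch P G i j n k -` (- Omega P)
      = {s. tn P G n \<le> s \<and> branch P G i j n k s \<notin> Omega P}" by auto
  ultimately show "closed (insert (tn P G (Suc n)) {s. tn P G n \<le> s \<and> branch P G i j n k s \<notin> Omega P})"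
    by simp
qed simp

lemma tau_bounds:
  shows "tn P G n \<le> tau P G i j n" and "tau P G i j n \<le> tn P G (Suc n)"
proof -
  obtain k where k: "tau P G i j n = tau_k P G i j n k"
    using tau_in_branch_exit_times by blast
  show "tn P G n \<le> tau P G i j n"
    unfolding k using tau_k_attained[of i j n k] dt_pos by (auto simp: tn_Suc)
  show "tau P G i j n \<le> tn P G (Suc n)"
    unfolding k tau_k_def using dt_pos
    by (intro cInf_lower bdd_belowI[of _ "tn P G n"]) (auto simp: tn_Suc)
qed

lemma branch_in_Omega_before_tau:
  assumes k: "k \<in> {1..4}" and s: "tn P G n \<le> s" "s < tau P G i j n"
  shows "branch P G i j n k s \<in> Omega P"
proof (rule ccontr)
  assume "branch P G i j n k s \<notin> Omega P"
  then have "tau_k P G i j n k \<le> s"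
    unfolding tau_k_def using s dt_pos
    by (intro cInf_lower bdd_belowI[of _ "tn P G n"]) (auto simp: tn_Suc)
  moreover have "tau P G i j n \<le> tau_k P G i j n k"
    unfolding tau_def using k by (intro Min_le) auto
  ultimately show False using s by linarith
qed

text \<open>Every branch is still inside before the common stopping time; the closure comes from
  passing to the limit.\<close>

lemma branch_at_tau_in_closure:
  assumes k: "k \<in> {1..4}" and ij: "interior_node G i j"
  shows "branch P G i j n k (tau P G i j n) \<in> closure (Omega P)"
proof (cases "tau P G i j n = tn P G n")
  case True
  then show ?thesis
    using interior_node_in_Omega[OF ij] closure_subset[of "Omega P"]
    by (auto simp: branch_eq branch_dx_def branch_dy_def)
next
  case False
  let ?I = "{tn P G n..<tau P G i j n}"
  have cl: "closure ?I = {tn P G n..tau P G i j n}"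
    using False tau_bounds(1)[where i = i and j = j and n = n] by (intro closure_atLeastLessThan) simp
  have "branch P G i j n k ` closure ?I \<subseteq> closure (Omega P)"
    using branch_in_Omega_before_tau[OF k] closure_subset[of "Omega P"]
    by (intro image_closure_subset continuous_on_branch) auto
  then show ?thesis using cl tau_bounds(1)[where i = i and j = j and n = n] by auto
qed

text \<open>An early stop is caused by some branch, and that branch ends on the boundary, where the
  numerical and the exact value agree. This is where the factor \<open>3/4\<close> in the error recursion
  comes from.\<close>

lemma early_stop_on_frontier:
  assumes ij: "interior_node G i j" and early: "tau P G i j n < tn P G (Suc n)"
  shows "\<exists>k \<in> {1..4}. branch P G i j n k (tau P G i j n) \<in> frontier (Omega P)"
proof -
  obtain k where k: "k \<in> {1..4}" "tau P G i j n = tau_k P G i j n k"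
    using tau_in_branch_exit_times by blast
  then have "branch P G i j n k (tau P G i j n) \<notin> Omega P"
    using tau_k_attained[of i j n k] early by auto
  then show ?thesis
    using branch_at_tau_in_closure[OF k(1) ij] by (intro bexI[OF _ k(1)]) (simp add: frontier_Omega)
qed

end

section \<open>Error recursion\<close>

text \<open>The scheme reads the terminal data on the lateral boundary and the boundary data at the
  terminal time, beyond the sets on which the Dirichlet problem prescribes them. By continuity
  they agree with the exact solution there as well.\<close>

lemma terminal_value_on_closure:
  assumes adm: "admissible P" and data: "data_continuous P" and sol: "exact_solution P f"
    and cont: "continuous_on3 (closure (Omega P)) {0..horizon P} f"
    and xy: "(x, y) \<in> closure (Omega P)"
  shows "f x y (horizon P) = phi P x y"
proof -
  have T: "0 \<le> horizon P" using adm by (simp add: admissible_def)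
  have "continuous_on (closure (Omega P)) (\<lambda>z. (\<lambda>((x, y), t). f x y t) (z, horizon P))"
    using cont unfolding continuous_on3_def
    by (rule continuous_on_compose2[where f = "\<lambda>z. (z, horizon P)"])
       (use T in \<open>auto intro!: continuous_intros\<close>)
  then have "continuous_on (closure (Omega P))
      (\<lambda>z. (\<lambda>((x, y), t). f x y t) (z, horizon P) - (\<lambda>(x, y). phi P x y) z)"
    using data unfolding data_continuous_def by (intro continuous_on_diff) auto
  moreover have "(\<lambda>z. (\<lambda>((x, y), t). f x y t) (z, horizon P) - (\<lambda>(x, y). phi P x y) z) ` Omega P
      \<subseteq> {0}"
    using sol by (auto simp: exact_solution_def)
  ultimately have "(\<lambda>z. (\<lambda>((x, y), t). f x y t) (z, horizon P) - (\<lambda>(x, y). phi P x y) z)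
      ` closure (Omega P) \<subseteq> {0}"
    by (intro image_closure_subset) auto
  then show ?thesis using xy by force
qed

lemma boundary_value_up_to_terminal_time:
  assumes adm: "admissible P" and data: "data_continuous P" and sol: "exact_solution P f"
    and cont: "continuous_on3 (closure (Omega P)) {0..horizon P} f"
    and xy: "(x, y) \<in> frontier (Omega P)" and t: "t \<in> {0..horizon P}"
  shows "f x y t = fbd P x y t"
proof -
  have cl: "closure {0..<horizon P} = {0..horizon P}"
    using adm by (intro closure_atLeastLessThan) (simp add: admissible_def)
  have "continuous_on {0..horizon P} (\<lambda>t. (\<lambda>((x, y), t). f x y t) ((x, y), t))"
    using cont unfolding continuous_on3_def
    by (rule continuous_on_compose2[where f = "\<lambda>t. ((x, y), t)"])
       (use xy in \<open>auto simp: frontier_def intro!: continuous_intros\<close>)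
  moreover have "continuous_on {0..horizon P} (\<lambda>t. (\<lambda>((x, y), t). fbd P x y t) ((x, y), t))"
    using data[unfolded data_continuous_def continuous_on3_def, THEN conjunct2]
    by (rule continuous_on_compose2[where f = "\<lambda>t. ((x, y), t)"])
       (use xy in \<open>auto intro!: continuous_intros\<close>)
  ultimately have "continuous_on (closure {0..<horizon P}) (\<lambda>t. f x y t - fbd P x y t)"
    unfolding cl by (intro continuous_on_diff) simp_all
  moreover have "(\<lambda>t. f x y t - fbd P x y t) ` {0..<horizon P} \<subseteq> {0}"
    using sol xy by (auto simp: exact_solution_def)
  ultimately have "(\<lambda>t. f x y t - fbd P x y t) ` closure {0..<horizon P} \<subseteq> {0}"
    by (intro image_closure_subset) auto
  then show ?thesis using t unfolding cl by force
qed

lemma node_error_le_error_norm: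
  assumes "i \<le> M1 G" and "j \<le> M2 G"
  shows "\<bar>fh n i j - f (xn P G i) (yn P G j) (tn P G n)\<bar> \<le> error_norm P G f fh n"
  unfolding error_norm_def using assms
  by (intro Max_ge) (auto intro!: rev_image_eqI[of "(i, j)"])

lemma error_norm_le:
  assumes "\<And>i j. i \<le> M1 G \<Longrightarrow> j \<le> M2 G \<Longrightarrow>
             \<bar>fh n i j - f (xn P G i) (yn P G j) (tn P G n)\<bar> \<le> X"
  shows "error_norm P G f fh n \<le> X"
  unfolding error_norm_def using assms by (intro Max.boundedI) auto

lemma error_norm_nonneg: "0 \<le> error_norm P G f fh n"
  using node_error_le_error_norm[of 0 G 0 fh n f P] by simp

text \<open>The constants \<open>B\<close> and \<open>K\<close> are parameters chosen before the grid, so that the final constant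
  is the same for all grids.\<close>

locale scheme_error = square_grid +
  fixes f :: "real \<Rightarrow> real \<Rightarrow> real \<Rightarrow> real" and fh :: "nat \<Rightarrow> nat \<Rightarrow> nat \<Rightarrow> real"
    and B K :: real
  assumes data: "data_continuous P" and sol: "exact_solution P f"
    and cont: "continuous_on3 (closure (Omega P)) {0..horizon P} f"
    and num: "numerical_solution P G fh"
    and derivs: "bounded_derivs P B 4 f"
    and K1: "1 \<le> K"
    and coeffs: "\<And>x y t. (x, y) \<in> Omega P \<Longrightarrow> t \<in> {0..<horizon P} \<Longrightarrow>
         \<bar>drift1 P x y t\<bar> \<le> K \<and> \<bar>drift2 P x y t\<bar> \<le> K \<and>
         2 * \<bar>sigma1 P x y t\<bar> \<le> K \<and> 2 * \<bar>sigma2 P x y t\<bar> \<le> K"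
begin

abbreviation err :: "nat \<Rightarrow> real" where "err n \<equiv> error_norm P G f fh n"

definition truncation_const :: real where
  "truncation_const = (24 * (K * (1 + sqrt (horizon P))) ^ 4
     + 2 * (4 * K\<^sup>2 + 4 * K + 3 * K ^ 3 * (horizon P + 3))) * B"

definition local_const :: real where "local_const = 3 * B + truncation_const / 4"

lemma B_nonneg: "0 \<le> B"
  using bounded_derivs_abs_le[OF derivs node_in_cyl[of 0 0 0]] by simp

lemma truncation_const_nonneg: "0 \<le> truncation_const"
proof -
  have "0 \<le> horizon P" using adm by (simp add: admissible_def)
  then show ?thesis
    unfolding truncation_const_def using B_nonneg K1
    by (intro mult_nonneg_nonneg add_nonneg_nonneg zero_le_power) auto
qed

lemma local_const_nonneg: "0 \<le> local_const"
  using B_nonneg truncation_const_nonneg by (simp add: local_const_def)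

lemma derivs2: "bounded_derivs P B 2 f"
  using derivs by (rule bounded_derivs_lower_order) simp

lemma err_terminal: "err (N G) = 0"
proof -
  have "\<bar>fh (N G) i j - f (xn P G i) (yn P G j) (tn P G (N G))\<bar> \<le> 0"
    if "i \<le> M1 G" "j \<le> M2 G" for i j
  proof -
    have "(xn P G i, yn P G j) \<in> closure (Omega P)"
      using node_in_cyl[OF that, of 0] by (simp add: closure_Omega[OF adm] in_cyl_def)
    then have "f (xn P G i) (yn P G j) (horizon P) = phi P (xn P G i) (yn P G j)"
      by (rule terminal_value_on_closure[OF adm data sol cont])
    then show ?thesis
      using num that end_nodes(3) by (simp add: numerical_solution_def tn_def)
  qed
  then have "err (N G) \<le> 0" by (rule error_norm_le)
  then show ?thesis using error_norm_nonneg[of P G f fh "N G"] by linarith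
qed

definition branch_error :: "nat \<Rightarrow> nat \<Rightarrow> nat \<Rightarrow> nat \<Rightarrow> real" where
  "branch_error i j n k =
     U P G fh i j n k
     - f (fst (branch P G i j n k (tau P G i j n))) (snd (branch P G i j n k (tau P G i j n)))
         (tau P G i j n)"

context
  fixes i j n :: nat
  assumes ij: "interior_node G i j" and n: "n < N G"
begin

lemma tau_in_horizon: "tau P G i j n \<in> {0..horizon P}"
proof -
  have "tn P G n \<in> {0..horizon P}" "tn P G (Suc n) \<in> {0..horizon P}"
    using node_in_cyl[of 0 0 n] node_in_cyl[of 0 0 "Suc n"] n by (auto simp: in_cyl_def)
  then show ?thesis using tau_bounds[where i = i and j = j and n = n] by simp
qed

lemma branch_error_frontier:
  assumes "branch P G i j n k (tau P G i j n) \<in> frontier (Omega P)"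
  shows "branch_error i j n k = 0"
  using boundary_value_up_to_terminal_time[OF adm data sol cont _ tau_in_horizon] assms
  by (simp add: branch_error_def U_def Let_def)

lemma branch_error_late:
  assumes k: "k \<in> {1..4}" and late: "tau P G i j n = tn P G (Suc n)"
  shows "\<bar>branch_error i j n k\<bar> \<le> err (Suc n) + 3 * B * h\<^sup>2"
proof (cases "branch P G i j n k (tau P G i j n) \<in> frontier (Omega P)")
  case True
  then show ?thesis
    using branch_error_frontier error_norm_nonneg[of P G f fh "Suc n"] B_nonneg by simp
next
  case False
  obtain x y where z: "branch P G i j n k (tau P G i j n) = (x, y)" by (metis surj_pair)
  have "(x, y) \<in> closure (Omega P)"
    using branch_at_tau_in_closure[OF k ij, of n] z by simp
  then have "\<bar>interp_sp P G fh (Suc n) (x, y) - f x y (tn P G (Suc n))\<bar> \<le> err (Suc n) + 2 * B * h\<^sup>2"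
    using n by (intro interp_sp_error derivs2 node_error_le_error_norm) auto
  moreover have "0 \<le> B * h\<^sup>2" using B_nonneg by simp
  ultimately show ?thesis
    using False z late by (simp add: branch_error_def U_def Let_def)
qed

lemma branch_error_early:
  assumes k: "k \<in> {1..4}" and early: "tau P G i j n < tn P G (Suc n)"
  shows "\<bar>branch_error i j n k\<bar> \<le> max (err n) (err (Suc n)) + 3 * B * h\<^sup>2"
proof (cases "branch P G i j n k (tau P G i j n) \<in> frontier (Omega P)")
  case True
  then show ?thesis
    using branch_error_frontier error_norm_nonneg[of P G f fh n] B_nonneg by simp
next
  case False
  obtain x y where z: "branch P G i j n k (tau P G i j n) = (x, y)" by (metis surj_pair)
  have cl: "(x, y) \<in> closure (Omega P)"
    using branch_at_tau_in_closure[OF k ij, of n] z by simp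
  have node: "\<bar>fh m i' j' - f (xn P G i') (yn P G j') (tn P G m)\<bar> \<le> max (err n) (err (Suc n))"
    if "m \<in> {n, Suc n}" "i' \<le> M1 G" "j' \<le> M2 G" for m i' j'
    using node_error_le_error_norm[OF that(2,3), of fh m f P] that(1) by auto
  have "\<bar>interp_st P G fh n (x, y) (tau P G i j n) - f x y (tau P G i j n)\<bar>
          \<le> max (err n) (err (Suc n)) + 3 * B * h\<^sup>2"
    using tau_bounds[where i = i and j = j and n = n] by (intro interp_st_error derivs2 cl n node)
  then show ?thesis
    using False z early by (simp add: branch_error_def U_def Let_def)
qed

text \<open>The scheme averages the branch values and the exact solution does so up to the truncation
  error; dividing by \<open>1 + r * \<delta> \<ge> 1\<close>, where \<open>\<delta>\<close> is the time to the stop, can only shrink the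
  difference.\<close>

lemma interior_error_le_mean_branch_error:
  "\<bar>fh n i j - f (xn P G i) (yn P G j) (tn P G n)\<bar>
     \<le> (\<Sum>k = 1..4. \<bar>branch_error i j n k\<bar>) / 4 + truncation_const / 4 * h\<^sup>2"
proof -
  define x y t where "x = xn P G i" and "y = yn P G j" and "t = tn P G n"
  define ta d where "ta = tau P G i j n" and "d = tau P G i j n - tn P G n"
  have d: "0 \<le> d" "d \<le> h" "t + d = ta"
    using tau_bounds[where i = i and j = j and n = n] by (auto simp: d_def t_def ta_def tn_Suc)
  have xy: "(x, y) \<in> Omega P" unfolding x_def y_def by (rule interior_node_in_Omega[OF ij])
  have t: "t \<in> {0..<horizon P}" unfolding t_def by (rule tn_less_horizon[OF n])
  define g where "g k = f (x + branch_dx P x y t k d) (y + branch_dy P x y t k d) (t + d)" for k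
  have br: "branch P G i j n k ta = (x + branch_dx P x y t k d, y + branch_dy P x y t k d)" for k
    by (simp add: branch_eq x_def y_def t_def ta_def d_def)
  have "\<bar>(\<Sum>k = 1..4. g k) - 4 * (1 + rate P x y t * d) * f x y t\<bar> \<le> truncation_const * d\<^sup>2"
    unfolding g_def truncation_const_def
  proof (rule branches_consistent[OF adm _ derivs xy t])
    show "solves_pde P f" using sol by (simp add: exact_solution_def)
    show "in_cyl P (x + branch_dx P x y t k d) (y + branch_dy P x y t k d) (t + d)"
      if "k \<in> {1..4}" for k
      using branch_at_tau_in_closure[OF that ij, of n] tau_in_horizon d(3)
      unfolding ta_def[symmetric] br by (simp add: closure_Omega[OF adm] in_cyl_def)
  qed (use coeffs[OF xy t] K1 d dt_le_horizon in auto)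
  also have "\<dots> \<le> truncation_const * h\<^sup>2"
    using truncation_const_nonneg d by (intro mult_left_mono power_mono) auto
  finally have tr: "\<bar>(\<Sum>k = 1..4. g k) - 4 * (1 + rate P x y t * d) * f x y t\<bar>
      \<le> truncation_const * h\<^sup>2" .
  have "0 \<le> rate P x y t" using adm xy t unfolding admissible_def by blast
  then have q: "1 \<le> 1 + rate P x y t * d" using d by simp
  have "fh n i j = 1 / (4 * (1 + rate P x y t * d)) * (\<Sum>k = 1..4. U P G fh i j n k)"
    using num n ij by (simp add: numerical_solution_def interior_node_def x_def y_def t_def d_def)
  then have sys: "4 * (1 + rate P x y t * d) * fh n i j = (\<Sum>k = 1..4. U P G fh i j n k)"
    using q by (simp add: field_simps)
  have be: "branch_error i j n k = U P G fh i j n k - g k" for k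
    unfolding branch_error_def ta_def[symmetric] br by (simp add: g_def d(3))
  have "4 * \<bar>fh n i j - f x y t\<bar> \<le> (1 + rate P x y t * d) * (4 * \<bar>fh n i j - f x y t\<bar>)"
    using mult_right_mono[OF q, of "4 * \<bar>fh n i j - f x y t\<bar>"] by simp
  also have "\<dots> = \<bar>4 * (1 + rate P x y t * d) * (fh n i j - f x y t)\<bar>"
    using q by (simp add: abs_mult)
  also have "4 * (1 + rate P x y t * d) * (fh n i j - f x y t)
      = (\<Sum>k = 1..4. branch_error i j n k)
        + ((\<Sum>k = 1..4. g k) - 4 * (1 + rate P x y t * d) * f x y t)"
    unfolding be sum_subtractf sys[symmetric] by (simp add: algebra_simps)
  also have "\<bar>\<dots>\<bar> \<le> (\<Sum>k = 1..4. \<bar>branch_error i j n k\<bar>) + truncation_const * h\<^sup>2"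
    by (intro order_trans[OF abs_triangle_ineq] add_mono sum_abs tr)
  finally show ?thesis by (simp add: x_def y_def t_def)
qed

lemma interior_error_recursion:
  "\<bar>fh n i j - f (xn P G i) (yn P G j) (tn P G n)\<bar>
     \<le> max (err (Suc n)) (3/4 * max (err n) (err (Suc n))) + local_const * h\<^sup>2"
proof (cases "tau P G i j n = tn P G (Suc n)")
  case True
  have "(\<Sum>k = 1..4. \<bar>branch_error i j n k\<bar>) \<le> of_nat (card {1..4::nat}) * (err (Suc n) + 3 * B * h\<^sup>2)"
    by (intro sum_bounded_above branch_error_late True)
  then have "(\<Sum>k = 1..4. \<bar>branch_error i j n k\<bar>) / 4 \<le> err (Suc n) + 3 * B * h\<^sup>2" by simp
  then show ?thesis
    using interior_error_le_mean_branch_error unfolding local_const_def distrib_right by linarith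
next
  case False
  then have early: "tau P G i j n < tn P G (Suc n)" using tau_bounds(2)[where i = i and j = j and n = n] by simp
  obtain k0 where k0: "k0 \<in> {1..4}" "branch P G i j n k0 (tau P G i j n) \<in> frontier (Omega P)"
    using early_stop_on_frontier[OF ij early] by blast
  have "(\<Sum>k = 1..4. \<bar>branch_error i j n k\<bar>)
      = \<bar>branch_error i j n k0\<bar> + (\<Sum>k \<in> {1..4} - {k0}. \<bar>branch_error i j n k\<bar>)"
    using k0(1) by (intro sum.remove) auto
  also have "\<dots> = (\<Sum>k \<in> {1..4} - {k0}. \<bar>branch_error i j n k\<bar>)"
    using branch_error_frontier[OF k0(2)] by simp
  also have "\<dots> \<le> of_nat (card ({1..4} - {k0})) * (max (err n) (err (Suc n)) + 3 * B * h\<^sup>2)"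
    using early by (intro sum_bounded_above branch_error_early) auto
  also have "card ({1..4} - {k0}) = 3" using k0(1) by simp
  finally have "(\<Sum>k = 1..4. \<bar>branch_error i j n k\<bar>) / 4
      \<le> 3/4 * max (err n) (err (Suc n)) + 9/4 * (B * h\<^sup>2)"
    by (simp add: algebra_simps)
  moreover have "0 \<le> B * h\<^sup>2" using B_nonneg by simp
  moreover have "local_const * h\<^sup>2 = 3 * (B * h\<^sup>2) + truncation_const / 4 * h\<^sup>2"
    by (simp add: local_const_def algebra_simps)
  ultimately show ?thesis
    using interior_error_le_mean_branch_error by linarith
qed

end

text \<open>If the maximal error at level \<open>n\<close> exceeds the one at level \<open>n + 1\<close> and sits at a node with
  an early stop, the contraction gives \<open>err n \<le> 3/4 * err n + O(h\<^sup>2)\<close>. Hence the \<open>O(h\<^sup>2)\<close>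
  interpolation errors at such nodes, whose time step may be much shorter than \<open>h\<close>, do not
  accumulate within the implicit level.\<close>

lemma err_step:
  assumes n: "n < N G"
  shows "err n \<le> err (Suc n) + 4 * local_const * h\<^sup>2"
proof -
  have A: "0 \<le> local_const * h\<^sup>2" using local_const_nonneg by simp
  have "err n \<le> max (err (Suc n)) (3/4 * max (err n) (err (Suc n))) + local_const * h\<^sup>2"
  proof (rule error_norm_le)
    fix i j assume ij: "i \<le> M1 G" "j \<le> M2 G"
    show "\<bar>fh n i j - f (xn P G i) (yn P G j) (tn P G n)\<bar>
            \<le> max (err (Suc n)) (3/4 * max (err n) (err (Suc n))) + local_const * h\<^sup>2"
    proof (cases "interior_node G i j")
      case True
      then show ?thesis using n by (rule interior_error_recursion)
    next
      case False
      have "tn P G n \<in> {0..<horizon P}" by (rule tn_less_horizon[OF n])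
      then have "f (xn P G i) (yn P G j) (tn P G n) = fbd P (xn P G i) (yn P G j) (tn P G n)"
        using sol boundary_node_in_frontier[OF ij False] unfolding exact_solution_def by blast
      then have "fh n i j = f (xn P G i) (yn P G j) (tn P G n)"
        using num n ij False by (simp add: numerical_solution_def)
      then show ?thesis
        using A error_norm_nonneg[of P G f fh "Suc n"] by simp
    qed
  qed
  then show ?thesis
    using A error_norm_nonneg[of P G f fh n] error_norm_nonneg[of P G f fh "Suc n"]
    by (auto simp: max_def split: if_splits)
qed

lemma err_bound:
  assumes "n \<le> N G"
  shows "err n \<le> 4 * local_const * horizon P * h"
proof -
  have "err n \<le> real (N G - n) * (4 * local_const * h\<^sup>2)"
    using assms
  proof (induction n rule: inc_induct)
    case base
    show ?case by (simp add: err_terminal)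
  next
    case (step n)
    have "real (N G - n) = real (N G - Suc n) + 1" using step.hyps by simp
    then show ?case using err_step[OF step.hyps(2)] step.IH by (simp add: algebra_simps)
  qed
  also have "\<dots> \<le> real (N G) * (4 * local_const * h\<^sup>2)"
    using local_const_nonneg by (intro mult_right_mono) auto
  also have "\<dots> = 4 * local_const * (real (N G) * h) * h"
    by (simp add: power2_eq_square)
  finally show ?thesis by (simp add: end_nodes(3))
qed

end

theorem theorem2:
  fixes P :: problem and f :: "real \<Rightarrow> real \<Rightarrow> real \<Rightarrow> real"
  assumes "admissible P"
    and "\<forall>g \<in> {sigma1 P, sigma2 P, drift1 P, drift2 P}.
           bounded_on3 (Omega P) {0..<horizon P} g"
    and "data_continuous P"
    and "exact_solution P f"
    and "smooth_cyl P 4 f"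
  shows "\<exists>C. \<forall>G fh. 1 \<le> M1 G \<and> 1 \<le> M2 G \<and> 1 \<le> N G
           \<and> dt P G = h1 P G \<and> h1 P G = h2 P G
           \<and> numerical_solution P G fh
           \<longrightarrow> (\<forall>n \<le> N G. error_norm P G f fh n \<le> C * dt P G)"
proof -
  obtain B where B: "bounded_derivs P B 4 f"
    using smooth_cyl_imp_bounded_derivs[OF assms(1,5)] by blast
  have bdd: "\<exists>b. \<forall>x y t. (x, y) \<in> Omega P \<longrightarrow> t \<in> {0..<horizon P} \<longrightarrow> \<bar>g x y t\<bar> \<le> b"
    if "g \<in> {sigma1 P, sigma2 P, drift1 P, drift2 P}" for g
  proof -
    have "bounded ((\<lambda>((x, y), t). g x y t) ` (Omega P \<times> {0..<horizon P}))"
      using assms(2) that unfolding bounded_on3_def by blast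
    then obtain b where "\<forall>z \<in> (\<lambda>((x, y), t). g x y t) ` (Omega P \<times> {0..<horizon P}). \<bar>z\<bar> \<le> b"
      by (auto simp: bounded_iff)
    then have "\<forall>x y t. (x, y) \<in> Omega P \<longrightarrow> t \<in> {0..<horizon P} \<longrightarrow> \<bar>g x y t\<bar> \<le> b"
      by force
    then show ?thesis by blast
  qed
  obtain c1 where c1: "\<forall>x y t. (x, y) \<in> Omega P \<longrightarrow> t \<in> {0..<horizon P} \<longrightarrow> \<bar>sigma1 P x y t\<bar> \<le> c1"
    using bdd[of "sigma1 P"] by auto
  obtain c2 where c2: "\<forall>x y t. (x, y) \<in> Omega P \<longrightarrow> t \<in> {0..<horizon P} \<longrightarrow> \<bar>sigma2 P x y t\<bar> \<le> c2"
    using bdd[of "sigma2 P"] by auto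
  obtain c3 where c3: "\<forall>x y t. (x, y) \<in> Omega P \<longrightarrow> t \<in> {0..<horizon P} \<longrightarrow> \<bar>drift1 P x y t\<bar> \<le> c3"
    using bdd[of "drift1 P"] by auto
  obtain c4 where c4: "\<forall>x y t. (x, y) \<in> Omega P \<longrightarrow> t \<in> {0..<horizon P} \<longrightarrow> \<bar>drift2 P x y t\<bar> \<le> c4"
    using bdd[of "drift2 P"] by auto
  define K where "K = 1 + 2 * \<bar>c1\<bar> + 2 * \<bar>c2\<bar> + \<bar>c3\<bar> + \<bar>c4\<bar>"
  have coeffs: "\<bar>drift1 P x y t\<bar> \<le> K \<and> \<bar>drift2 P x y t\<bar> \<le> K \<and>
         2 * \<bar>sigma1 P x y t\<bar> \<le> K \<and> 2 * \<bar>sigma2 P x y t\<bar> \<le> K"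
    if "(x, y) \<in> Omega P" "t \<in> {0..<horizon P}" for x y t
  proof -
    have "\<bar>sigma1 P x y t\<bar> \<le> c1" "\<bar>sigma2 P x y t\<bar> \<le> c2" "\<bar>drift1 P x y t\<bar> \<le> c3" "\<bar>drift2 P x y t\<bar> \<le> c4"
      using c1 c2 c3 c4 that by blast+
    then show ?thesis unfolding K_def by linarith
  qed
  have err: "error_norm P G f fh n
      \<le> 4 * scheme_error.local_const P B K * horizon P * dt P G"
    if hyp: "1 \<le> M1 G \<and> 1 \<le> M2 G \<and> 1 \<le> N G \<and> dt P G = h1 P G \<and> h1 P G = h2 P G
      \<and> numerical_solution P G fh" and n: "n \<le> N G" for G fh n
  proof -
    interpret scheme_error P G f fh B K
      using hyp assms B coeffs smooth_cyl_continuous[OF assms(5)]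
      by unfold_locales (auto simp: K_def)
    show ?thesis using n by (rule err_bound)
  qed
  show ?thesis
    by (intro exI[of _ "4 * scheme_error.local_const P B K * horizon P"]) (use err in blast)
qed

end
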